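(* Suppose that $\pi_0\in\Phi^+\cap C\cap U$ is an equalizer prior, and that one of the following holds: R1 holds with $\pi=\pi_0$ and $\liminf_{n\to\infty}m_n/n>0$; or R2 holds with $\pi=\pi_0$ and $m_n\to\infty$; or R3 holds with $\pi=\pi_0$ and $(m_n)$ is any sequence of positive integers (R1, R2, R3 being defined in the context and understood to hold for $\pi^J$ as well). Then $\pi_0$ is minimax and $$\zeta(\pi_0)=\inf_{\tau\in\Phi}\zeta(\tau).$$
   Context: Let $\Theta\subset\mathbb{R}^p$ be open, $p\ge1$; $X_1,X_2,\dots$ are independent observations from a density $f(\cdot|\theta)$, $\theta\in\Theta$, with respect to a $\sigma$-finite measure $\mu$. For a sequence $(m_n)$ of positive integers, $X=(X_1,\dots,X_n)$, $Y=(X_{n+1},\dots,X_{n+m_n})$, $c_n=2n(n+m_n)/m_n$. A prior $\pi$ is a measure on $\Theta$, possibly improper; $p^\pi(x)=\int p(x|\theta)\,d\pi(\theta)$ and $p^\pi(y|x)$ is the posterior predictive density of $Y$ given $X=x$. $\Pi$ is the class of priors with $p^\pi(X)<\infty$ almost surely under every $\theta\in\Theta$; $\Omega\subset\Pi$ is the class of proper priors. $d_X(\theta,\pi)=\int\log\{p(x|\theta)/p^\pi(x)\}p(x|\theta)\,d\mu(x)$. $\Pi_\infty$ is the class of $\pi\in\Pi$ such that, for all $n$, $d_X(\theta,\pi)<\infty$ for all $\theta\in\Theta$. $C$ is the class of $\pi\in\Pi_\infty$ possessing densities (also denoted $\pi$) with continuous second-order derivatives throughout $\Theta$. Jeffreys'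 prior is $\pi^J(\theta)=|i(\theta)|^{1/2}$, with $i(\theta)$ the Fisher information matrix per observation; it is assumed that $\pi^J\in C$; $p^J$ denotes predictive densities under $\pi^J$. $\Omega_\infty$ is the class of $\tau\in\Omega$ with $\int d_X(\theta,\pi^J)\,d\tau(\theta)<\infty$ for all $n$. For $\pi\in\Pi_\infty$, $\tau\in\Omega_\infty$: $L_{Y|X}(\theta,\pi)=\iint\log\{p^J(y|x)/p^\pi(y|x)\}p(x,y|\theta)\,d\mu(x)\,d\mu(y)$, $L_{Y|X}(\tau,\pi)=\int L_{Y|X}(\theta,\pi)\,d\tau(\theta)$, $L(\tau,\pi)=\limsup_{n\to\infty}c_nL_{Y|X}(\tau,\pi)$, and $L(\theta,\pi)=L(\{\theta\},\pi)$ with $\{\theta\}$ the prior degenerate at $\theta$. For $\tau\in\Omega_\infty\cap\Pi_\infty$, the predictive information is $\zeta(\tau)=-L(\tau,\tau)$; $\Phi$ is the class of $\tau\in\Omega_\infty\cap\Pi_\infty$ with $\zeta(\tau)<\infty$. For $\pi\in\Pi_\infty$, $\tau\in\Phi$, $d(\tau,\pi)=L(\tau,\pi)+\zeta(\tau)$. $\pi\in\Pi_\infty$ is an equalizer prior if $L(\theta,\pi)$ is constant over $\theta\in\Theta$. $\pi_0\in\Pi_\infty$ is minimax if $\sup_{\tau\in\Phi}L(\tau,\pi_0)=\inf_{\pi\in\Pi_\infty}\sup_{\tau\in\Phi}L(\tau,\pi)$. $\Phi^+$ is the class of $\pi\in\Pi_\infty$ for which there exists a sequence $(\tau_k)$ in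 $\Phi$ such that (i) $L(\tau_k,\pi)=\int L(\theta,\pi)\,d\tau_k(\theta)$ for all $k$ and (ii) $d(\tau_k,\pi)\to0$ as $k\to\infty$. If $\pi\in\Phi^+$ is an equalizer prior, its predictive information is defined by $\zeta(\pi)=\lim_{k\to\infty}\zeta(\tau_k)$ for any sequence $(\tau_k)$ in $\Phi$ satisfying (i) and (ii) (the limit exists and does not depend on the sequence). $U$ is the class of $\pi\in\Pi_\infty$ for which $\limsup_{n\to\infty}c_n\sup_{\theta\in\Theta}L_{Y|X}(\theta,\pi)<\infty$ for every sequence $(m_n)$. Remainder conditions: for $\pi\in C$, write (with $2\pi e$ involving the number $3.14159\ldots$) $$d_X(\theta,\pi)=\frac p2\log\Big(\frac n{2\pi e}\Big)+\log\Big\{\frac{|i(\theta)|^{1/2}}{\pi(\theta)}\Big\}-\frac{D(\theta,\pi)}{2n}-r_n(\theta,\pi)$$ with $D(\theta,\pi)$ continuous in $\theta$ and independent of $n$. R1: $r_n(\theta,\pi)=o(n^{-1})$ uniformly in compacts of $\Theta$. R2: $r_n(\theta,\pi)=O(n^{-2})$ uniformly in compacts. R3: $r_n(\theta,\pi)=E(\theta,\pi)n^{-2}+o(n^{-2})$ uniformly in compacts, with $E(\theta,\pi)$ continuous in $\theta$. *)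

theory Defs
  imports "HOL-Probability.Probability"
begin

section \<open>Extended-valued integrals and logarithms\<close>

text \<open>
  Relative entropies and regrets may be infinite, whereas the Bochner integral returns 0 for
  every non-integrable function.  Here \<open>ext_integral N f\<close> is the integral of the positive part
  minus the integral of the negative part.  If both are infinite the value is \<open>\<infinity>\<close>
  (\<open>\<infinity> - \<infinity> = \<infinity>\<close> in \<^typ>\<open>ereal\<close>), so that \<open>ext_integral N f < \<infinity>\<close> also says that the
  integral is well defined.
\<close>

definition ext_integral :: "'a measure \<Rightarrow> ('a \<Rightarrow> ereal) \<Rightarrow> ereal" where
  "ext_integral N f =
     enn2ereal (\<integral>\<^sup>+ x. e2ennreal (f x) \<partial>N) - enn2ereal (\<integral>\<^sup>+ x. e2ennreal (- f x) \<partial>N)"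

text \<open>The logarithm with \<open>log 0 = -\<infinity>\<close> and \<open>log \<infinity> = \<infinity>\<close> (on \<^typ>\<open>real\<close>, \<open>ln 0 = 0\<close>).\<close>

definition ext_ln :: "ennreal \<Rightarrow> ereal" where
  "ext_ln t = (if t = 0 then - \<infinity> else if t = \<infinity> then \<infinity> else ereal (ln (enn2real t)))"


section \<open>The statistical model\<close>

text \<open>\<open>obs_density M x \<theta>\<close> is \<open>f(x|\<theta>)\<close>; the dimension \<open>p\<close> is \<open>CARD('p)\<close>.\<close>

record ('x, 'p) model =
  base_measure :: "'x measure"
  params :: "(real ^ 'p) set"
  obs_density :: "'x \<Rightarrow> real ^ 'p \<Rightarrow> real"

text \<open>
  Joint measurability of the density is what makes the integrals over the parameter and the
  marginal densities meaningful.
\<close>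

definition valid_model :: "('x, 'p::finite) model \<Rightarrow> bool" where
  "valid_model M \<longleftrightarrow>
     sigma_finite_measure (base_measure M) \<and>
     open (params M) \<and>
     (\<lambda>(x, \<theta>). obs_density M x \<theta>) \<in>
       borel_measurable (base_measure M \<Otimes>\<^sub>M restrict_space borel (params M)) \<and>
     (\<forall>\<theta>\<in>params M. (\<forall>x\<in>space (base_measure M). 0 \<le> obs_density M x \<theta>) \<and>
        (\<integral>\<^sup>+ x. ennreal (obs_density M x \<theta>) \<partial>base_measure M) = 1)"

text \<open>
  A sample \<open>z\<close> is a function on the indices; \<open>X\<close> consists of the coordinates \<open>1, \<dots>, n\<close> and
  \<open>Y\<close> of the coordinates \<open>n + 1, \<dots>, n + m\<close>.
\<close>

definition lik :: "('x, 'p::finite) model \<Rightarrow> nat set \<Rightarrow> (nat \<Rightarrow> 'x) \<Rightarrow> real ^ 'p \<Rightarrow> real" where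
  "lik M I z \<theta> = (\<Prod>i\<in>I. obs_density M (z i) \<theta>)"

definition sample_measure :: "('x, 'p::finite) model \<Rightarrow> nat \<Rightarrow> (nat \<Rightarrow> 'x) measure" where
  "sample_measure M k = Pi\<^sub>M {1..k} (\<lambda>_. base_measure M)"

definition sampling_law ::
    "('x, 'p::finite) model \<Rightarrow> nat \<Rightarrow> real ^ 'p \<Rightarrow> (nat \<Rightarrow> 'x) measure" where
  "sampling_law M n \<theta> = density (sample_measure M n) (\<lambda>x. ennreal (lik M {1..n} x \<theta>))"

definition marginal ::
    "('x, 'p::finite) model \<Rightarrow> nat \<Rightarrow> (real ^ 'p) measure \<Rightarrow> (nat \<Rightarrow> 'x) \<Rightarrow> ennreal" where
  "marginal M n \<pi> x = (\<integral>\<^sup>+ \<theta>. ennreal (lik M {1..n} x \<theta>) \<partial>\<pi>)"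

definition posterior ::
    "('x, 'p::finite) model \<Rightarrow> nat \<Rightarrow> (real ^ 'p) measure \<Rightarrow> (nat \<Rightarrow> 'x) \<Rightarrow> (real ^ 'p) measure" where
  "posterior M n \<pi> x = density \<pi> (\<lambda>\<theta>. ennreal (lik M {1..n} x \<theta>) / marginal M n \<pi> x)"

definition predictive ::
    "('x, 'p::finite) model \<Rightarrow> nat \<Rightarrow> nat \<Rightarrow> (real ^ 'p) measure \<Rightarrow> (nat \<Rightarrow> 'x) \<Rightarrow> ennreal" where
  "predictive M n m \<pi> z = (\<integral>\<^sup>+ \<theta>. ennreal (lik M {n+1..n+m} z \<theta>) \<partial>posterior M n \<pi> z)"


section \<open>Classes of priors\<close>

text \<open>
  Priors are sigma-finite Borel measures on the parameter set; sigma-finiteness is needed for the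
  marginal to be a measurable function of the data and for Tonelli's theorem.
\<close>

definition prior :: "('x, 'p::finite) model \<Rightarrow> (real ^ 'p) measure \<Rightarrow> bool" where
  "prior M \<pi> \<longleftrightarrow> sets \<pi> = sets (restrict_space borel (params M)) \<and> sigma_finite_measure \<pi>"

definition Pi_class :: "('x, 'p::finite) model \<Rightarrow> (real ^ 'p) measure set" where
  "Pi_class M = {\<pi>. prior M \<pi> \<and>
     (\<forall>n\<ge>1. \<forall>\<theta>\<in>params M. AE x in sampling_law M n \<theta>. marginal M n \<pi> x < \<infinity>)}"

definition Omega_class :: "('x, 'p::finite) model \<Rightarrow> (real ^ 'p) measure set" where
  "Omega_class M = {\<tau> \<in> Pi_class M. prob_space \<tau>}"

definition d_X :: "('x, 'p::finite) model \<Rightarrow> nat \<Rightarrow> real ^ 'p \<Rightarrow> (real ^ 'p) measure \<Rightarrow> ereal" where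
  "d_X M n \<theta> \<pi> = ext_integral (sample_measure M n)
     (\<lambda>x. ext_ln (ennreal (lik M {1..n} x \<theta>) / marginal M n \<pi> x) * ereal (lik M {1..n} x \<theta>))"

definition Pi_inf :: "('x, 'p::finite) model \<Rightarrow> (real ^ 'p) measure set" where
  "Pi_inf M = {\<pi> \<in> Pi_class M. \<forall>n\<ge>1. \<forall>\<theta>\<in>params M. d_X M n \<theta> \<pi> < \<infinity>}"

definition C2_on :: "(real ^ 'p::finite) set \<Rightarrow> (real ^ 'p \<Rightarrow> real) \<Rightarrow> bool" where
  "C2_on S g \<longleftrightarrow> (\<exists>(G :: real ^ 'p \<Rightarrow> real ^ 'p) (H :: real ^ 'p \<Rightarrow> real ^ 'p ^ 'p).
     (\<forall>\<theta>\<in>S. (g has_derivative (\<lambda>h. G \<theta> \<bullet> h)) (at \<theta>) \<and>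
             (G has_derivative (\<lambda>h. H \<theta> *v h)) (at \<theta>)) \<and>
     continuous_on S H)"

definition measure_of_density ::
    "('x, 'p::finite) model \<Rightarrow> (real ^ 'p \<Rightarrow> real) \<Rightarrow> (real ^ 'p) measure" where
  "measure_of_density M g = density (restrict_space lborel (params M)) (\<lambda>\<theta>. ennreal (g \<theta>))"

definition is_C2_density ::
    "('x, 'p::finite) model \<Rightarrow> (real ^ 'p) measure \<Rightarrow> (real ^ 'p \<Rightarrow> real) \<Rightarrow> bool" where
  "is_C2_density M \<pi> g \<longleftrightarrow>
     (\<forall>\<theta>\<in>params M. 0 \<le> g \<theta>) \<and> C2_on (params M) g \<and> \<pi> = measure_of_density M g"

definition C_class :: "('x, 'p::finite) model \<Rightarrow> (real ^ 'p) measure set" where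
  "C_class M = {\<pi> \<in> Pi_inf M. \<exists>g. is_C2_density M \<pi> g}"

text \<open>Being continuous, the density of a member of \<open>C_class M\<close> is unique on the open parameter set.\<close>

definition prior_density :: "('x, 'p::finite) model \<Rightarrow> (real ^ 'p) measure \<Rightarrow> real ^ 'p \<Rightarrow> real" where
  "prior_density M \<pi> = (SOME g. is_C2_density M \<pi> g)"


section \<open>Fisher information and Jeffreys' prior\<close>

definition score :: "('x, 'p::finite) model \<Rightarrow> 'x \<Rightarrow> real ^ 'p \<Rightarrow> 'p \<Rightarrow> real" where
  "score M x \<theta> j = frechet_derivative (\<lambda>t. ln (obs_density M x t)) (at \<theta>) (axis j 1)"

definition fisher_info :: "('x, 'p::finite) model \<Rightarrow> real ^ 'p \<Rightarrow> real ^ 'p ^ 'p" where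
  "fisher_info M \<theta> =
     (\<chi> j k. \<integral> x. score M x \<theta> j * score M x \<theta> k * obs_density M x \<theta> \<partial>base_measure M)"

text \<open>The conditions under which the formula above really defines the Fisher information matrix.\<close>

definition fisher_info_exists :: "('x, 'p::finite) model \<Rightarrow> bool" where
  "fisher_info_exists M \<longleftrightarrow> (\<forall>\<theta>\<in>params M.
     (AE x in base_measure M. 0 < obs_density M x \<theta> \<longrightarrow>
        (\<lambda>t. obs_density M x t) differentiable (at \<theta>)) \<and>
     (\<forall>j k. integrable (base_measure M)
        (\<lambda>x. score M x \<theta> j * score M x \<theta> k * obs_density M x \<theta>)))"

definition jeffreys_density :: "('x, 'p::finite) model \<Rightarrow> real ^ 'p \<Rightarrow> real" where
  "jeffreys_density M \<theta> = sqrt (det (fisher_info M \<theta>))"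

definition jeffreys_prior :: "('x, 'p::finite) model \<Rightarrow> (real ^ 'p) measure" where
  "jeffreys_prior M = measure_of_density M (jeffreys_density M)"

definition Omega_inf :: "('x, 'p::finite) model \<Rightarrow> (real ^ 'p) measure set" where
  "Omega_inf M = {\<tau> \<in> Omega_class M.
     \<forall>n\<ge>1. ext_integral \<tau> (\<lambda>\<theta>. d_X M n \<theta> (jeffreys_prior M)) < \<infinity>}"


section \<open>Predictive regret and predictive information\<close>

definition L_YX ::
    "('x, 'p::finite) model \<Rightarrow> nat \<Rightarrow> nat \<Rightarrow> real ^ 'p \<Rightarrow> (real ^ 'p) measure \<Rightarrow> ereal" where
  "L_YX M n m \<theta> \<pi> = ext_integral (sample_measure M (n + m))
     (\<lambda>z. ext_ln (predictive M n m (jeffreys_prior M) z / predictive M n m \<pi> z)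
            * ereal (lik M {1..n+m} z \<theta>))"

definition L_YX_avg ::
    "('x, 'p::finite) model \<Rightarrow> nat \<Rightarrow> nat \<Rightarrow> (real ^ 'p) measure \<Rightarrow> (real ^ 'p) measure \<Rightarrow> ereal" where
  "L_YX_avg M n m \<tau> \<pi> = ext_integral \<tau> (\<lambda>\<theta>. L_YX M n m \<theta> \<pi>)"

definition c_seq :: "(nat \<Rightarrow> nat) \<Rightarrow> nat \<Rightarrow> real" where
  "c_seq m n = 2 * real n * (real n + real (m n)) / real (m n)"

definition L ::
    "('x, 'p::finite) model \<Rightarrow> (nat \<Rightarrow> nat) \<Rightarrow> (real ^ 'p) measure \<Rightarrow> (real ^ 'p) measure \<Rightarrow> ereal" where
  "L M m \<tau> \<pi> = limsup (\<lambda>n. ereal (c_seq m n) * L_YX_avg M n (m n) \<tau> \<pi>)"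

definition L_point ::
    "('x, 'p::finite) model \<Rightarrow> (nat \<Rightarrow> nat) \<Rightarrow> real ^ 'p \<Rightarrow> (real ^ 'p) measure \<Rightarrow> ereal" where
  "L_point M m \<theta> \<pi> = L M m (return (restrict_space borel (params M)) \<theta>) \<pi>"

definition zeta :: "('x, 'p::finite) model \<Rightarrow> (nat \<Rightarrow> nat) \<Rightarrow> (real ^ 'p) measure \<Rightarrow> ereal" where
  "zeta M m \<tau> = - L M m \<tau> \<tau>"

definition Phi :: "('x, 'p::finite) model \<Rightarrow> (nat \<Rightarrow> nat) \<Rightarrow> (real ^ 'p) measure set" where
  "Phi M m = {\<tau> \<in> Omega_inf M \<inter> Pi_inf M. zeta M m \<tau> < \<infinity>}"

definition d_pred ::
    "('x, 'p::finite) model \<Rightarrow> (nat \<Rightarrow> nat) \<Rightarrow> (real ^ 'p) measure \<Rightarrow> (real ^ 'p) measure \<Rightarrow> ereal" where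
  "d_pred M m \<tau> \<pi> = L M m \<tau> \<pi> + zeta M m \<tau>"

definition equalizer :: "('x, 'p::finite) model \<Rightarrow> (nat \<Rightarrow> nat) \<Rightarrow> (real ^ 'p) measure \<Rightarrow> bool" where
  "equalizer M m \<pi> \<longleftrightarrow> \<pi> \<in> Pi_inf M \<and> (\<exists>c. \<forall>\<theta>\<in>params M. L_point M m \<theta> \<pi> = c)"

definition minimax :: "('x, 'p::finite) model \<Rightarrow> (nat \<Rightarrow> nat) \<Rightarrow> (real ^ 'p) measure \<Rightarrow> bool" where
  "minimax M m \<pi>\<^sub>0 \<longleftrightarrow> \<pi>\<^sub>0 \<in> Pi_inf M \<and>
     (SUP \<tau>\<in>Phi M m. L M m \<tau> \<pi>\<^sub>0) = (INF \<pi>\<in>Pi_inf M. SUP \<tau>\<in>Phi M m. L M m \<tau> \<pi>)"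

definition approximating_sequence ::
    "('x, 'p::finite) model \<Rightarrow> (nat \<Rightarrow> nat) \<Rightarrow> (real ^ 'p) measure \<Rightarrow> (nat \<Rightarrow> (real ^ 'p) measure) \<Rightarrow> bool" where
  "approximating_sequence M m \<pi> \<tau> \<longleftrightarrow>
     (\<forall>k. \<tau> k \<in> Phi M m) \<and>
     (\<forall>k. L M m (\<tau> k) \<pi> = ext_integral (\<tau> k) (\<lambda>\<theta>. L_point M m \<theta> \<pi>)) \<and>
     (\<lambda>k. d_pred M m (\<tau> k) \<pi>) \<longlonglongrightarrow> 0"

definition Phi_plus :: "('x, 'p::finite) model \<Rightarrow> (nat \<Rightarrow> nat) \<Rightarrow> (real ^ 'p) measure set" where
  "Phi_plus M m = {\<pi> \<in> Pi_inf M. \<exists>\<tau>. approximating_sequence M m \<pi> \<tau>}"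

text \<open>The predictive information of an equalizer prior in \<open>Phi_plus M m\<close>, which need not be proper.\<close>

definition zeta_plus :: "('x, 'p::finite) model \<Rightarrow> (nat \<Rightarrow> nat) \<Rightarrow> (real ^ 'p) measure \<Rightarrow> ereal" where
  "zeta_plus M m \<pi> =
     (THE z. \<forall>\<tau>. approximating_sequence M m \<pi> \<tau> \<longrightarrow> (\<lambda>k. zeta M m (\<tau> k)) \<longlonglongrightarrow> z)"

definition U_class :: "('x, 'p::finite) model \<Rightarrow> (real ^ 'p) measure set" where
  "U_class M = {\<pi> \<in> Pi_inf M. \<forall>m. (\<forall>n\<ge>1. 0 < m n) \<longrightarrow>
     limsup (\<lambda>n. ereal (c_seq m n) * (SUP \<theta>\<in>params M. L_YX M n (m n) \<theta> \<pi>)) < \<infinity>}"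


section \<open>Remainder conditions\<close>

text \<open>
  \<open>remainder M D \<pi> n \<theta>\<close> is the term \<open>r\<^sub>n(\<theta>,\<pi>)\<close> of the expansion of \<open>d_X\<close>, for a given
  coefficient function \<open>D\<close>.  It is infinite whenever the determinant of the Fisher information
  or the prior density vanishes at \<open>\<theta>\<close>, or \<open>d_X\<close> is infinite there, so each of the conditions
  below excludes these cases on every compact set for all large \<open>n\<close>.
\<close>

definition remainder ::
    "('x, 'p::finite) model \<Rightarrow> (real ^ 'p \<Rightarrow> real) \<Rightarrow> (real ^ 'p) measure \<Rightarrow> nat \<Rightarrow> real ^ 'p \<Rightarrow> ereal" where
  "remainder M D \<pi> n \<theta> =
     ereal (real CARD('p) / 2 * ln (real n / (2 * pi * exp 1)))
     + ext_ln (ennreal (sqrt (det (fisher_info M \<theta>))) / ennreal (prior_density M \<pi> \<theta>))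
     - ereal (D \<theta> / (2 * real n)) - d_X M n \<theta> \<pi>"

definition R1 :: "('x, 'p::finite) model \<Rightarrow> (real ^ 'p) measure \<Rightarrow> bool" where
  "R1 M \<pi> \<longleftrightarrow> (\<exists>D. continuous_on (params M) D \<and>
     (\<forall>K. compact K \<and> K \<subseteq> params M \<longrightarrow> (\<forall>\<epsilon>>0. \<exists>N. \<forall>n\<ge>N. \<forall>\<theta>\<in>K.
        \<bar>remainder M D \<pi> n \<theta>\<bar> \<le> ereal (\<epsilon> / real n))))"

definition R2 :: "('x, 'p::finite) model \<Rightarrow> (real ^ 'p) measure \<Rightarrow> bool" where
  "R2 M \<pi> \<longleftrightarrow> (\<exists>D. continuous_on (params M) D \<and>
     (\<forall>K. compact K \<and> K \<subseteq> params M \<longrightarrow> (\<exists>B N. \<forall>n\<ge>N. \<forall>\<theta>\<in>K.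
        \<bar>remainder M D \<pi> n \<theta>\<bar> \<le> ereal (B / (real n)\<^sup>2))))"

definition R3 :: "('x, 'p::finite) model \<Rightarrow> (real ^ 'p) measure \<Rightarrow> bool" where
  "R3 M \<pi> \<longleftrightarrow> (\<exists>D E. continuous_on (params M) D \<and> continuous_on (params M) E \<and>
     (\<forall>K. compact K \<and> K \<subseteq> params M \<longrightarrow> (\<forall>\<epsilon>>0. \<exists>N. \<forall>n\<ge>N. \<forall>\<theta>\<in>K.
        \<bar>remainder M D \<pi> n \<theta> - ereal (E \<theta> / (real n)\<^sup>2)\<bar> \<le> ereal (\<epsilon> / (real n)\<^sup>2))))"

end

theory Submission
  imports Defs
begin

text \<open>
  For proper \<open>\<tau>\<close>, the posterior predictive density of \<open>\<tau>\<close> is the Bayes rule under logarithmic loss,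
  so \<open>L(\<tau>,\<tau>) \<le> L(\<tau>,\<pi>)\<close> for every \<open>\<pi>\<close>: with \<open>R = p\<^sup>\<pi>(y|x) / p\<^sup>\<tau>(y|x)\<close> one has
  \<open>log (1/R) \<ge> 1 - R\<close>, and \<open>R\<close> has mean at most 1 under the joint law of parameter and data.
  If \<open>L(\<theta>,\<pi>\<^sub>0) = c\<close> for all \<open>\<theta>\<close>, the uniform bound in the definition of \<open>U\<close> permits a reverse
  Fatou argument, which gives \<open>L(\<tau>,\<pi>\<^sub>0) \<le> c\<close> for all \<open>\<tau>\<close>.  Hence \<open>\<zeta>(\<tau>) \<ge> -c\<close> on \<open>\<Phi>\<close>, while
  \<open>\<zeta>(\<tau>\<^sub>k) \<rightarrow> -c\<close> along a sequence approximating \<open>\<pi>\<^sub>0\<close>; for any \<open>\<pi>\<close> the supremum of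
  \<open>L(\<tau>,\<pi>)\<close> is at least the limit of \<open>L(\<tau>\<^sub>k,\<tau>\<^sub>k)\<close>, which is \<open>c\<close>.
\<close>

section \<open>Extended-valued integrals: comparison and a reverse Fatou inequality\<close>

lemma measurable_ext_ln [measurable]: "ext_ln \<in> borel_measurable borel"
  unfolding ext_ln_def[abs_def] by measurable

text \<open>Positive and negative parts may have infinite integrals, so an inequality between
  differences cannot be integrated as it stands. With the subtracted parts moved across, both sides
  are nonnegative and monotonicity of the nonnegative integral applies. The second inequality
  controls the positive part of \<open>a\<close> on its own.\<close>

lemma pos_neg_part_le:
  fixes a b :: ereal and F G :: ennreal
  assumes le: "a \<le> b + (enn2ereal G - enn2ereal F)" and "b < \<infinity>" "G < \<infinity>"
  shows "e2ennreal a + e2ennreal (- b) + F \<le> e2ennreal (- a) + e2ennreal b + G"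
    and "e2ennreal a \<le> e2ennreal b + G"
proof -
  have split_parts: "ennreal x + ennreal (- y) + ennreal s \<le> ennreal (- x) + ennreal y + ennreal t
      \<and> ennreal x \<le> ennreal y + ennreal t"
    if "x \<le> y + (t - s)" "0 \<le> s" "0 \<le> t" for x y s t :: real
  proof -
    have "max 0 x + max 0 (- y) + s \<le> max 0 (- x) + max 0 y + t" "max 0 x \<le> max 0 y + t"
      using that by auto
    then have "ennreal (max 0 x + max 0 (- y) + s) \<le> ennreal (max 0 (- x) + max 0 y + t)"
      "ennreal (max 0 x) \<le> ennreal (max 0 y + t)"
      by (auto intro!: ennreal_leI simp del: ennreal_max_0)
    with that show ?thesis
      by (simp add: ennreal_plus)
  qed
  obtain t where t: "G = ennreal t" "0 \<le> t"
    using \<open>G < \<infinity>\<close> by (cases G) auto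
  have "(e2ennreal a + e2ennreal (- b) + F \<le> e2ennreal (- a) + e2ennreal b + G)
      \<and> e2ennreal a \<le> e2ennreal b + G"
  \<comment> \<open>If \<open>a\<close> is -\<infinity>, then \<open>e2ennreal (- a)\<close> is
    infinite on the right. Otherwise \<open>le\<close> forces \<open>F\<close>, \<open>b\<close> and
    \<open>a\<close> to be finite, and the claim is one about real numbers.\<close>
  proof (cases "a = - \<infinity>")
    case True
    then show ?thesis
      by (simp add: e2ennreal_neg)
  next
    case False
    then obtain s where s: "F = ennreal s" "0 \<le> s"
      using assms t by (cases F; cases b; cases a) auto
    obtain y where y: "b = ereal y"
      using assms False t s by (cases b) auto
    obtain x where x: "a = ereal x"
      using assms False t s y by (cases a) auto
    show ?thesis
      using split_parts[of x y t s] le t s unfolding x y by simp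
  qed
  then show "e2ennreal a + e2ennreal (- b) + F \<le> e2ennreal (- a) + e2ennreal b + G"
    and "e2ennreal a \<le> e2ennreal b + G"
    by simp_all
qed

text \<open>The correction \<open>G - F\<close> will be a log ratio of predictive densities split
  into its parts, used first over the data and then over the parameter. Only \<open>G\<close> can be
  shown to be integrable there, so \<open>F\<close> may have infinite integral.\<close>

lemma ext_integral_le_add:
  fixes f g :: "'a \<Rightarrow> ereal" and F G :: "'a \<Rightarrow> ennreal"
  assumes [measurable]: "f \<in> borel_measurable N" "g \<in> borel_measurable N"
    "F \<in> borel_measurable N" "G \<in> borel_measurable N"
    and le: "AE x in N. f x \<le> g x + (enn2ereal (G x) - enn2ereal (F x))"
    and fin: "(\<integral>\<^sup>+ x. G x \<partial>N) < \<infinity>"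
  shows "ext_integral N f \<le>
    ext_integral N g + (enn2ereal (\<integral>\<^sup>+ x. G x \<partial>N) - enn2ereal (\<integral>\<^sup>+ x. F x \<partial>N))"
proof -
  let ?P = "\<lambda>h. \<integral>\<^sup>+ x. e2ennreal (h x) \<partial>N" and ?N = "\<lambda>h. \<integral>\<^sup>+ x. e2ennreal (- h x) \<partial>N"
  show ?thesis
  \<comment> \<open>An infinite positive part makes \<open>ext_integral N g\<close> equal to
    \<infinity> whatever the negative part is, and \<infinity> absorbs even a correction of
    -\<infinity>.\<close>
  proof (cases "?P g = \<infinity>")
    case True
    then show ?thesis
      by (auto simp: ext_integral_def)
  next
    case False
    have "AE x in N. e2ennreal (g x) \<noteq> \<infinity>"
      by (rule nn_integral_PInf_AE) (use False in auto)
    moreover have "AE x in N. G x \<noteq> \<infinity>"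
      by (rule nn_integral_PInf_AE) (use fin in auto)
    ultimately have ae: "AE x in N. e2ennreal (f x) + e2ennreal (- g x) + F x
          \<le> e2ennreal (- f x) + e2ennreal (g x) + G x
        \<and> e2ennreal (f x) \<le> e2ennreal (g x) + G x"
      using le
    proof eventually_elim
      case (elim x)
      then have "g x < \<infinity>" "G x < \<infinity>"
        by (auto simp: top.not_eq_extremum less_top)
      then show ?case
        using pos_neg_part_le elim by blast
    qed
    have "?P f \<le> (\<integral>\<^sup>+ x. e2ennreal (g x) + G x \<partial>N)"
      by (rule nn_integral_mono_AE) (use ae in auto)
    also have "\<dots> = ?P g + (\<integral>\<^sup>+ x. G x \<partial>N)"
      by (rule nn_integral_add) auto
    finally have Pf: "?P f < \<infinity>"
      using False fin by (auto simp: less_top[symmetric] top_unique)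
    have "(\<integral>\<^sup>+ x. e2ennreal (f x) + e2ennreal (- g x) + F x \<partial>N) \<le>
        (\<integral>\<^sup>+ x. e2ennreal (- f x) + e2ennreal (g x) + G x \<partial>N)"
      by (rule nn_integral_mono_AE) (use ae in auto)
    then have main: "?P f + ?N g + (\<integral>\<^sup>+ x. F x \<partial>N) \<le> ?N f + ?P g + (\<integral>\<^sup>+ x. G x \<partial>N)"
      by (simp add: nn_integral_add)
    obtain pf pg iG where real: "?P f = ennreal pf" "0 \<le> pf" "?P g = ennreal pg" "0 \<le> pg"
      "(\<integral>\<^sup>+ x. G x \<partial>N) = ennreal iG" "0 \<le> iG"
      using Pf False fin
      by (cases "?P f"; cases "?P g"; cases "\<integral>\<^sup>+ x. G x \<partial>N") (auto simp: top_unique)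
    show ?thesis
    proof (cases "?N f")
      case top
      then show ?thesis
        using real by (simp add: ext_integral_def)
    next
      case (real nf)
      then show ?thesis
        using main \<open>?P f = ennreal pf\<close> \<open>0 \<le> pf\<close> \<open>?P g = ennreal pg\<close> \<open>0 \<le> pg\<close>
          \<open>(\<integral>\<^sup>+ x. G x \<partial>N) = ennreal iG\<close> \<open>0 \<le> iG\<close>
        by (cases "?N g"; cases "\<integral>\<^sup>+ x. F x \<partial>N")
          (auto simp: ext_integral_def top_unique simp flip: ennreal_plus)
    qed
  qed
qed

lemma ext_integral_cmult:
  assumes [measurable]: "f \<in> borel_measurable N" and "0 < c"
  shows "ext_integral N (\<lambda>x. ereal c * f x) = ereal c * ext_integral N f"
proof -
  have *: "e2ennreal (ereal c * y) = ennreal c * e2ennreal y" for y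
    using \<open>0 < c\<close> by (cases y) (auto simp: ennreal_mult' e2ennreal_neg ennreal_mult_top)
  have **: "e2ennreal (- (ereal c * y)) = ennreal c * e2ennreal (- y)" for y
    using *[of "- y"] by simp
  then show ?thesis
    unfolding ext_integral_def * **
    using \<open>0 < c\<close>
    by (cases "\<integral>\<^sup>+ x. e2ennreal (f x) \<partial>N"; cases "\<integral>\<^sup>+ x. e2ennreal (- f x) \<partial>N")
      (auto simp: nn_integral_cmult ennreal_mult_top algebra_simps simp flip: ennreal_mult)
qed

lemma ext_integral_const:
  assumes "prob_space N" and "\<And>x. x \<in> space N \<Longrightarrow> f x = c"
  shows "ext_integral N f = c"
proof -
  interpret prob_space N by fact
  have "ext_integral N f = ext_integral N (\<lambda>_. c)"
    unfolding ext_integral_def by (simp add: assms(2) cong: nn_integral_cong)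
  also have "\<dots> = c"
    by (cases c; cases "0 \<le> c") (auto simp: ext_integral_def emeasure_space_1 e2ennreal_neg ennreal_neg zero_ennreal.rep_eq)
  finally show ?thesis .
qed

lemma ext_integral_return:
  assumes [measurable]: "f \<in> borel_measurable N" and "x \<in> space N"
  shows "ext_integral (return N x) f = f x"
proof -
  have "ext_integral (return N x) f = enn2ereal (e2ennreal (f x)) - enn2ereal (e2ennreal (- f x))"
    unfolding ext_integral_def using assms(2) by (subst (1 2) nn_integral_return) auto
  also have "\<dots> = f x"
    by (cases "f x"; cases "0 \<le> f x") (auto simp: e2ennreal_neg ennreal_neg zero_ennreal.rep_eq)
  finally show ?thesis .
qed

text \<open>A reverse Fatou inequality in which the functions are bounded from above only. Fix
  \<open>d\<close> slightly above \<open>c\<close>. The positive part \<open>G n\<close> of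
  \<open>f n - d\<close> is at most the constant \<open>B - d\<close> and is eventually zero at each
  point, so dominated convergence sends its integral to 0, while the integral of \<open>f n\<close>
  exceeds \<open>d\<close> by at most that amount.\<close>

lemma limsup_ext_integral_le:
  fixes f :: "nat \<Rightarrow> 'a \<Rightarrow> ereal"
  assumes "prob_space N" and [measurable]: "\<And>n. f n \<in> borel_measurable N"
    and bound: "\<forall>\<^sub>F n in sequentially. \<forall>x\<in>space N. f n x \<le> ereal B"
    and lim: "\<And>x. x \<in> space N \<Longrightarrow> limsup (\<lambda>n. f n x) \<le> ereal c"
  shows "limsup (\<lambda>n. ext_integral N (f n)) \<le> ereal c"
proof (rule ereal_le_epsilon2)
  interpret prob_space N by fact
  fix e :: real assume "0 < e"
  define d where "d = c + e"
  define G where "G n x = e2ennreal (f n x - ereal d)" for n x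
  have [measurable]: "G n \<in> borel_measurable N" for n
    unfolding G_def by measurable
  obtain n0 where n0: "\<And>n x. n \<ge> n0 \<Longrightarrow> x \<in> space N \<Longrightarrow> f n x \<le> ereal B"
    using bound unfolding eventually_sequentially by blast
  have GB: "G n x \<le> ennreal (B - d)" if "n \<ge> n0" "x \<in> space N" for n x
  proof -
    have "f n x - ereal d \<le> ereal (B - d)"
      using n0[OF that] by (cases "f n x") auto
    then show ?thesis
      unfolding G_def by (metis e2ennreal_ereal e2ennreal_mono)
  qed
  \<comment> \<open>The bound by \<open>B\<close> holds only from \<open>n0\<close> on, so the
    sequence is shifted before dominated convergence is applied.\<close>
  have "(\<lambda>n. \<integral>\<^sup>+ x. G (n + n0) x \<partial>N) \<longlonglongrightarrow> (\<integral>\<^sup>+ x. 0 \<partial>N)"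
  proof (rule nn_integral_dominated_convergence[where w = "\<lambda>_. ennreal (B - d)"])
    show "AE x in N. (\<lambda>n. G (n + n0) x) \<longlonglongrightarrow> 0"
    proof (rule AE_I2)
      fix x assume "x \<in> space N"
      have "limsup (\<lambda>n. f n x) < ereal d"
        by (rule le_less_trans[OF lim[OF \<open>x \<in> space N\<close>]]) (simp add: d_def \<open>0 < e\<close>)
      then have "\<forall>\<^sub>F n in sequentially. f n x < ereal d"
        by (rule Limsup_lessD)
      then have "\<forall>\<^sub>F n in sequentially. G n x = 0"
      proof eventually_elim
        case (elim n)
        then have "f n x - ereal d \<le> 0"
          by (cases "f n x") auto
        then show ?case
          by (simp add: G_def e2ennreal_neg)
      qed
      then have "(\<lambda>n. G n x) \<longlonglongrightarrow> 0"
        by (rule tendsto_eventually)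
      then show "(\<lambda>n. G (n + n0) x) \<longlonglongrightarrow> 0"
        by (rule LIMSEQ_ignore_initial_segment)
    qed
    show "(\<integral>\<^sup>+ x. ennreal (B - d) \<partial>N) < \<infinity>"
      by (simp add: emeasure_space_1)
  qed (use GB in auto)
  then have "(\<lambda>n. \<integral>\<^sup>+ x. G n x \<partial>N) \<longlonglongrightarrow> 0"
    by (simp add: LIMSEQ_offset)
  then have "(\<lambda>n. enn2ereal (\<integral>\<^sup>+ x. G n x \<partial>N)) \<longlonglongrightarrow> 0"
    by (metis tendsto_enn2ereal_iff zero_ennreal.rep_eq)
  then have "(\<lambda>n. ereal d + enn2ereal (\<integral>\<^sup>+ x. G n x \<partial>N)) \<longlonglongrightarrow> ereal d + 0"
    by (intro tendsto_add_ereal) auto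
  then have "limsup (\<lambda>n. ereal d + enn2ereal (\<integral>\<^sup>+ x. G n x \<partial>N)) = ereal d"
    by (simp add: lim_imp_Limsup)
  moreover have "\<forall>\<^sub>F n in sequentially.
      ext_integral N (f n) \<le> ereal d + enn2ereal (\<integral>\<^sup>+ x. G n x \<partial>N)"
  proof (rule eventually_sequentiallyI[of n0])
    fix n assume "n0 \<le> n"
    have "ext_integral N (f n) \<le> ext_integral N (\<lambda>_. ereal d) +
        (enn2ereal (\<integral>\<^sup>+ x. G n x \<partial>N) - enn2ereal (\<integral>\<^sup>+ x. 0 \<partial>N))"
    proof (rule ext_integral_le_add)
      show "AE x in N. f n x \<le> ereal d + (enn2ereal (G n x) - enn2ereal 0)"
      proof (rule AE_I2)
        fix x
        show "f n x \<le> ereal d + (enn2ereal (G n x) - enn2ereal 0)"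
          unfolding G_def
          by (cases "f n x"; cases "ereal d \<le> f n x") (auto simp: ennreal_neg zero_ennreal.rep_eq)
      qed
      have "(\<integral>\<^sup>+ x. G n x \<partial>N) \<le> (\<integral>\<^sup>+ x. ennreal (B - d) \<partial>N)"
        using GB \<open>n0 \<le> n\<close> by (intro nn_integral_mono) auto
      then show "(\<integral>\<^sup>+ x. G n x \<partial>N) < \<infinity>"
        by (simp add: emeasure_space_1 le_less_trans)
    qed auto
    then show "ext_integral N (f n) \<le> ereal d + enn2ereal (\<integral>\<^sup>+ x. G n x \<partial>N)"
      using \<open>prob_space N\<close> by (simp add: ext_integral_const zero_ennreal.rep_eq)
  qed
  ultimately show "limsup (\<lambda>n. ext_integral N (f n)) \<le> ereal c + ereal e"
    using Limsup_mono[of "\<lambda>n. ext_integral N (f n)"] by (fastforce simp: d_def)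
qed

section \<open>Likelihoods: measurability, sign and total mass\<close>

locale statistical_model =
  fixes M :: "('x, 'p::finite) model"
  assumes valid: "valid_model M"

sublocale statistical_model \<subseteq> product_sigma_finite "\<lambda>_. base_measure M"
  using valid by (simp add: product_sigma_finite_def valid_model_def)

context statistical_model
begin

declare One_nat_def [simp del]

abbreviation param_space :: "(real ^ 'p) measure" where
  "param_space \<equiv> restrict_space borel (params M)"

lemma space_param_space [simp]: "space param_space = params M"
  by (simp add: space_restrict_space)

lemma prior_cong [measurable_cong]: "prior M \<pi> \<Longrightarrow> sets \<pi> = sets param_space"
  by (simp add: prior_def)

lemma space_prior: "prior M \<pi> \<Longrightarrow> space \<pi> = params M"
  using sets_eq_imp_space_eq[OF prior_cong] by simp

lemma sigma_finite_prior: "prior M \<pi> \<Longrightarrow> sigma_finite_measure \<pi>"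
  by (simp add: prior_def)

lemma sigma_finite_PiM: "finite J \<Longrightarrow> sigma_finite_measure (Pi\<^sub>M J (\<lambda>_. base_measure M))"
  by (rule sigma_finite)

lemma measurable_obs_density_pair:
  "(\<lambda>(x, \<theta>). obs_density M x \<theta>) \<in> borel_measurable (base_measure M \<Otimes>\<^sub>M param_space)"
  using valid by (simp add: valid_model_def)

lemma measurable_obs_density:
  "\<theta> \<in> params M \<Longrightarrow> (\<lambda>x. obs_density M x \<theta>) \<in> borel_measurable (base_measure M)"
  using measurable_Pair1[OF measurable_obs_density_pair, where y = \<theta>]
  by (simp only: split space_param_space)

lemma obs_density_nonneg:
  "\<theta> \<in> params M \<Longrightarrow> x \<in> space (base_measure M) \<Longrightarrow> 0 \<le> obs_density M x \<theta>"
  using valid by (simp add: valid_model_def)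

lemma nn_integral_obs_density:
  "\<theta> \<in> params M \<Longrightarrow> (\<integral>\<^sup>+ x. ennreal (obs_density M x \<theta>) \<partial>base_measure M) = 1"
  using valid by (simp add: valid_model_def)

text \<open>The coordinate set \<open>J\<close> may exceed \<open>I\<close> because the likelihoods
  of X and of Y are also read as functions of the joint sample.\<close>

lemma measurable_lik_pair:
  assumes "I \<subseteq> J"
  shows "(\<lambda>(z, \<theta>). lik M I z \<theta>) \<in> borel_measurable (Pi\<^sub>M J (\<lambda>_. base_measure M) \<Otimes>\<^sub>M param_space)"
proof -
  have "(\<lambda>p. obs_density M (fst p i) (snd p)) \<in>
      borel_measurable (Pi\<^sub>M J (\<lambda>_. base_measure M) \<Otimes>\<^sub>M param_space)" if "i \<in> I" for i
  proof -
    have "(\<lambda>p. (fst p i, snd p)) \<in>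
        Pi\<^sub>M J (\<lambda>_. base_measure M) \<Otimes>\<^sub>M param_space \<rightarrow>\<^sub>M base_measure M \<Otimes>\<^sub>M param_space"
      using subsetD[OF assms that] by measurable
    from measurable_compose[OF this measurable_obs_density_pair] show ?thesis
      by (simp only: split)
  qed
  then show ?thesis
    unfolding lik_def split_beta' by (rule borel_measurable_prod)
qed

lemma measurable_lik_prior:
  assumes "I \<subseteq> J" "prior M \<pi>"
  shows "(\<lambda>(z, \<theta>). ennreal (lik M I z \<theta>)) \<in> borel_measurable (Pi\<^sub>M J (\<lambda>_. base_measure M) \<Otimes>\<^sub>M \<pi>)"
proof -
  have [measurable]:
    "(\<lambda>(z, \<theta>). lik M I z \<theta>) \<in> borel_measurable (Pi\<^sub>M J (\<lambda>_. base_measure M) \<Otimes>\<^sub>M \<pi>)"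
    using measurable_lik_pair[OF assms(1)] prior_cong[OF assms(2)]
    by (simp cong: measurable_cong_sets sets_pair_measure_cong)
  show ?thesis
    by (simp add: split_beta')
qed

lemma measurable_lik:
  assumes "I \<subseteq> J" "\<theta> \<in> params M"
  shows "(\<lambda>z. lik M I z \<theta>) \<in> borel_measurable (Pi\<^sub>M J (\<lambda>_. base_measure M))"
  using measurable_Pair1[OF measurable_lik_pair[OF assms(1)], where y = \<theta>] assms(2)
  by (simp only: split space_param_space)

lemma measurable_lik_param:
  assumes "z \<in> space (Pi\<^sub>M J (\<lambda>_. base_measure M))" "I \<subseteq> J" "prior M \<pi>"
  shows "(\<lambda>\<theta>. ennreal (lik M I z \<theta>)) \<in> borel_measurable \<pi>"
  using measurable_compose_Pair1[OF assms(1) measurable_lik_prior[OF assms(2,3)]] by simp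

lemma lik_nonneg:
  assumes "z \<in> space (Pi\<^sub>M J (\<lambda>_. base_measure M))" "I \<subseteq> J" "\<theta> \<in> params M"
  shows "0 \<le> lik M I z \<theta>"
  using assms unfolding lik_def
  by (intro prod_nonneg) (auto simp: space_PiM PiE_iff intro!: obs_density_nonneg)

lemma nn_integral_lik:
  assumes "finite I" "\<theta> \<in> params M"
  shows "(\<integral>\<^sup>+ z. ennreal (lik M I z \<theta>) \<partial>Pi\<^sub>M I (\<lambda>_. base_measure M)) = 1"
proof -
  have "(\<integral>\<^sup>+ z. ennreal (lik M I z \<theta>) \<partial>Pi\<^sub>M I (\<lambda>_. base_measure M)) =
      (\<integral>\<^sup>+ z. (\<Prod>i\<in>I. ennreal (obs_density M (z i) \<theta>)) \<partial>Pi\<^sub>M I (\<lambda>_. base_measure M))"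
    unfolding lik_def
  proof (rule nn_integral_cong)
    fix z assume "z \<in> space (Pi\<^sub>M I (\<lambda>_. base_measure M))"
    then have "0 \<le> obs_density M (z i) \<theta>" if "i \<in> I" for i
      using that assms(2) by (auto simp: space_PiM PiE_iff intro!: obs_density_nonneg)
    then show "ennreal (\<Prod>i\<in>I. obs_density M (z i) \<theta>) = (\<Prod>i\<in>I. ennreal (obs_density M (z i) \<theta>))"
      by (simp add: prod_ennreal)
  qed
  also have "\<dots> = (\<Prod>i\<in>I. \<integral>\<^sup>+ x. ennreal (obs_density M x \<theta>) \<partial>base_measure M)"
    using assms measurable_obs_density[of \<theta>] by (intro product_nn_integral_prod) auto
  also have "\<dots> = 1"
    by (simp add: nn_integral_obs_density assms(2))
  finally show ?thesis .
qed

lemma lik_append: "lik M {1..n + k} z \<theta> = lik M {1..n} z \<theta> * lik M {n+1..n+k} z \<theta>"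
proof -
  have "{1..n + k} = {1..n} \<union> {n+1..n+k}"
    by auto
  then show ?thesis
    unfolding lik_def by (simp add: prod.union_disjoint)
qed

section \<open>Marginal and posterior predictive densities\<close>

lemma measurable_marginal:
  assumes "prior M \<pi>" "{1..n} \<subseteq> J"
  shows "marginal M n \<pi> \<in> borel_measurable (Pi\<^sub>M J (\<lambda>_. base_measure M))"
  unfolding marginal_def[abs_def]
  using sigma_finite_measure.borel_measurable_nn_integral[OF sigma_finite_prior[OF assms(1)]
      measurable_lik_prior[OF assms(2,1)]] .

text \<open>The likelihood of the joint sample factorises, and the posterior normalisation does not
  depend on the parameter. Both sides carry the same factor
  \<open>inverse (marginal M n \<pi> z)\<close>, so the identity also holds where that marginal is 0
  or \<infinity>.\<close>

lemma predictive_eq: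
  assumes "prior M \<pi>" "{1..n + k} \<subseteq> J" "z \<in> space (Pi\<^sub>M J (\<lambda>_. base_measure M))"
  shows "predictive M n k \<pi> z = marginal M (n + k) \<pi> z / marginal M n \<pi> z"
proof -
  have sub: "{1..n} \<subseteq> J" "{n+1..n+k} \<subseteq> J"
    using assms(2) by (auto simp: subset_eq)
  note [measurable] = measurable_lik_param[OF assms(3) sub(1) assms(1)]
    measurable_lik_param[OF assms(3) sub(2) assms(1)]
    measurable_lik_param[OF assms(3,2,1)]
  have "predictive M n k \<pi> z = (\<integral>\<^sup>+ \<theta>. ennreal (lik M {1..n} z \<theta>) / marginal M n \<pi> z *
      ennreal (lik M {n+1..n+k} z \<theta>) \<partial>\<pi>)"
    unfolding predictive_def posterior_def by (rule nn_integral_density) measurable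
  also have "\<dots> = (\<integral>\<^sup>+ \<theta>. ennreal (lik M {1..n + k} z \<theta>) * inverse (marginal M n \<pi> z) \<partial>\<pi>)"
    using lik_nonneg[OF assms(3) sub(1)] lik_nonneg[OF assms(3) sub(2)]
    by (intro nn_integral_cong)
      (simp add: lik_append space_prior[OF assms(1)] ennreal_mult divide_ennreal_def mult_ac)
  also have "\<dots> = marginal M (n + k) \<pi> z / marginal M n \<pi> z"
    unfolding marginal_def divide_ennreal_def by (rule nn_integral_multc) measurable
  finally show ?thesis .
qed

lemma measurable_predictive [measurable]:
  assumes "prior M \<pi>"
  shows "predictive M n k \<pi> \<in> borel_measurable (sample_measure M (n + k))"
proof -
  have [measurable]: "marginal M i \<pi> \<in> borel_measurable (sample_measure M (n + k))" if "i \<le> n + k" for i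
    unfolding sample_measure_def by (rule measurable_marginal) (use assms that in auto)
  have "(\<lambda>z. marginal M (n + k) \<pi> z / marginal M n \<pi> z) \<in> borel_measurable (sample_measure M (n + k))"
    by measurable
  then show ?thesis
    by (rule measurable_cong[THEN iffD1, rotated])
      (simp add: sample_measure_def predictive_eq[OF assms order_refl])
qed

lemma nn_integral_sample_split:
  assumes "f \<in> borel_measurable (sample_measure M (n + k))"
  shows "(\<integral>\<^sup>+ z. f z \<partial>sample_measure M (n + k)) =
    (\<integral>\<^sup>+ x. (\<integral>\<^sup>+ y. f (merge {1..n} {n+1..n+k} (x, y)) \<partial>Pi\<^sub>M {n+1..n+k} (\<lambda>_. base_measure M))
      \<partial>sample_measure M n)"
proof -
  have *: "{1..n + k} = {1..n} \<union> {n+1..n+k}"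
    by auto
  show ?thesis
    using assms unfolding sample_measure_def *
    by (intro product_nn_integral_fold) auto
qed

lemma lik_merge:
  "lik M {1..n} (merge {1..n} {n+1..n+k} (x, y)) \<theta> = lik M {1..n} x \<theta>"
  "lik M {n+1..n+k} (merge {1..n} {n+1..n+k} (x, y)) \<theta> = lik M {n+1..n+k} y \<theta>"
  unfolding lik_def by (auto intro!: prod.cong simp: merge_def)

lemma marginal_merge:
  "marginal M n \<pi> (merge {1..n} {n+1..n+k} (x, y)) = marginal M n \<pi> x"
  by (simp add: marginal_def lik_merge)

text \<open>Finiteness comes from the class \<Pi>. Positivity comes from finite relative entropy:
  where the marginal vanishes and the likelihood does not, the integrand of \<open>d_X\<close> is
  \<infinity>, so this can happen only on a null set.\<close>

lemma marginal_regular: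
  assumes \<pi>: "\<pi> \<in> Pi_inf M" and \<theta>: "\<theta> \<in> params M" and n: "n \<ge> 1"
  shows "AE x in sample_measure M n. 0 < lik M {1..n} x \<theta> \<longrightarrow>
    0 < marginal M n \<pi> x \<and> marginal M n \<pi> x < \<infinity>"
proof -
  have prior: "prior M \<pi>"
    using \<pi> by (simp add: Pi_inf_def Pi_class_def)
  have [measurable]: "(\<lambda>x. lik M {1..n} x \<theta>) \<in> borel_measurable (sample_measure M n)"
    "marginal M n \<pi> \<in> borel_measurable (sample_measure M n)"
    unfolding sample_measure_def
    by (rule measurable_lik measurable_marginal order_refl \<theta> prior)+
  let ?h = "\<lambda>x. ext_ln (ennreal (lik M {1..n} x \<theta>) / marginal M n \<pi> x) * ereal (lik M {1..n} x \<theta>)"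
  have "AE x in sampling_law M n \<theta>. marginal M n \<pi> x < \<infinity>"
    using \<pi> \<theta> n by (simp add: Pi_inf_def Pi_class_def)
  then have "AE x in sample_measure M n. 0 < lik M {1..n} x \<theta> \<longrightarrow> marginal M n \<pi> x < \<infinity>"
    unfolding sampling_law_def by (subst (asm) AE_density) auto
  moreover have "d_X M n \<theta> \<pi> < \<infinity>"
    using \<pi> \<theta> n by (simp add: Pi_inf_def)
  \<comment> \<open>Since \<infinity> - \<infinity> = \<infinity>, a value below \<infinity> forces
    the integral of the positive part to be finite.\<close>
  then have "(\<integral>\<^sup>+ x. e2ennreal (?h x) \<partial>sample_measure M n) \<noteq> \<infinity>"
    unfolding d_X_def ext_integral_def by auto
  then have "AE x in sample_measure M n. e2ennreal (?h x) \<noteq> \<infinity>"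
    by (intro nn_integral_PInf_AE) auto
  ultimately show ?thesis
  proof eventually_elim
    case (elim x)
    have "marginal M n \<pi> x \<noteq> 0" if "0 < lik M {1..n} x \<theta>"
    proof
      assume "marginal M n \<pi> x = 0"
      with that have "?h x = \<infinity>"
        by (simp add: ext_ln_def ennreal_divide_eq_top_iff)
      with elim show False
        by simp
    qed
    with elim show ?case
      by (auto simp: zero_less_iff_neq_zero)
  qed
qed

text \<open>Carries the exceptional set of X over to the joint sample: the likelihood of Y has total
  mass one, so integrating out \<open>y\<close> leaves the mass of the exceptional set under the law
  of X, which is zero.\<close>

lemma marginal_regular_append:
  assumes \<pi>: "\<pi> \<in> Pi_inf M" and \<theta>: "\<theta> \<in> params M" and n: "n \<ge> 1"
  shows "AE z in sample_measure M (n + k). 0 < lik M {1..n + k} z \<theta> \<longrightarrow>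
    0 < marginal M n \<pi> z \<and> marginal M n \<pi> z < \<infinity>"
proof -
  have prior: "prior M \<pi>"
    using \<pi> by (simp add: Pi_inf_def Pi_class_def)
  have [measurable]: "(\<lambda>x. lik M {1..n} x \<theta>) \<in> borel_measurable (sample_measure M n)"
    "marginal M n \<pi> \<in> borel_measurable (sample_measure M n)"
    "(\<lambda>z. lik M {1..n} z \<theta>) \<in> borel_measurable (sample_measure M (n + k))"
    "(\<lambda>z. lik M {n+1..n+k} z \<theta>) \<in> borel_measurable (sample_measure M (n + k))"
    "marginal M n \<pi> \<in> borel_measurable (sample_measure M (n + k))"
    unfolding sample_measure_def
    using \<theta> prior by (auto intro!: measurable_lik measurable_marginal)
  have [measurable]:
    "(\<lambda>y. lik M {n+1..n+k} y \<theta>) \<in> borel_measurable (Pi\<^sub>M {n+1..n+k} (\<lambda>_. base_measure M))"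
    by (rule measurable_lik order_refl \<theta>)+
  \<comment> \<open>\<open>h\<close> is the likelihood of X restricted to the exceptional set. It
    depends on the joint sample only through X.\<close>
  define h where "h x = ennreal (lik M {1..n} x \<theta>) *
    indicator {x. \<not> (0 < marginal M n \<pi> x \<and> marginal M n \<pi> x < \<infinity>)} x" for x
  have [measurable]: "h \<in> borel_measurable (sample_measure M n)"
    "h \<in> borel_measurable (sample_measure M (n + k))"
    unfolding h_def by measurable
  have "(\<integral>\<^sup>+ z. h z * ennreal (lik M {n+1..n+k} z \<theta>) \<partial>sample_measure M (n + k)) =
      (\<integral>\<^sup>+ x. (\<integral>\<^sup>+ y. h x * ennreal (lik M {n+1..n+k} y \<theta>)
        \<partial>Pi\<^sub>M {n+1..n+k} (\<lambda>_. base_measure M)) \<partial>sample_measure M n)"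
    by (subst nn_integral_sample_split)
      (simp_all add: h_def lik_merge marginal_merge indicator_def)
  also have "\<dots> = (\<integral>\<^sup>+ x. h x \<partial>sample_measure M n)"
    by (subst nn_integral_cmult) (simp_all add: nn_integral_lik \<theta>)
  also have "\<dots> = 0"
    by (subst nn_integral_0_iff_AE)
      (use marginal_regular[OF \<pi> \<theta> n] in \<open>auto simp: h_def ennreal_neg elim!: eventually_mono split: split_indicator\<close>)
  finally have "AE z in sample_measure M (n + k). h z * ennreal (lik M {n+1..n+k} z \<theta>) = 0"
    by (subst (asm) nn_integral_0_iff_AE) auto
  moreover have "AE z in sample_measure M (n + k). 0 \<le> lik M {1..n} z \<theta> \<and> 0 \<le> lik M {n+1..n+k} z \<theta>"
    unfolding sample_measure_def by (intro AE_I2 conjI lik_nonneg[OF _ _ \<theta>]) auto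
  ultimately show ?thesis
  proof eventually_elim
    case (elim z)
    show ?case
    proof
      assume "0 < lik M {1..n + k} z \<theta>"
      then have "0 < lik M {1..n} z \<theta>" "0 < lik M {n+1..n+k} z \<theta>"
        using elim by (auto simp: lik_append zero_less_mult_iff)
      with elim show "0 < marginal M n \<pi> z \<and> marginal M n \<pi> z < \<infinity>"
        by (auto simp: h_def zero_less_iff_neq_zero split: split_indicator_asm)
    qed
  qed
qed

text \<open>Ensures that logarithms of predictive ratios are real wherever the likelihood is
  positive. Elsewhere the factor 0 annihilates the integrand, even against an infinite
  logarithm.\<close>

lemma predictive_regular:
  assumes \<pi>: "\<pi> \<in> Pi_inf M" and \<theta>: "\<theta> \<in> params M" and n: "n \<ge> 1"
  shows "AE z in sample_measure M (n + k). 0 < lik M {1..n + k} z \<theta> \<longrightarrow>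
    0 < predictive M n k \<pi> z \<and> predictive M n k \<pi> z < \<infinity>"
proof -
  have prior: "prior M \<pi>"
    using \<pi> by (simp add: Pi_inf_def Pi_class_def)
  have "AE z in sample_measure M (n + k).
      predictive M n k \<pi> z = marginal M (n + k) \<pi> z / marginal M n \<pi> z"
    unfolding sample_measure_def by (intro AE_I2 predictive_eq[OF prior order_refl])
  moreover have "AE z in sample_measure M (n + k). 0 < lik M {1..n + k} z \<theta> \<longrightarrow>
      0 < marginal M (n + k) \<pi> z \<and> marginal M (n + k) \<pi> z < \<infinity>"
    using n by (intro marginal_regular[OF \<pi> \<theta>]) simp
  ultimately show ?thesis
    using marginal_regular_append[OF \<pi> \<theta> n, of k]
    by eventually_elim
      (auto simp: ennreal_zero_less_divide ennreal_divide_eq_top_iff less_top[symmetric])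
qed

section \<open>Predictive regret: integrands and measurability in the parameter\<close>

text \<open>Both priors are left free: with Jeffreys' prior first this is the integrand of
  \<open>L_YX\<close>, while Bayes optimality of \<tau> compares \<tau> with \<pi> directly.\<close>

definition log_ratio_integrand ::
    "nat \<Rightarrow> nat \<Rightarrow> (real ^ 'p) measure \<Rightarrow> (real ^ 'p) measure \<Rightarrow> real ^ 'p \<Rightarrow> (nat \<Rightarrow> 'x) \<Rightarrow> ereal"
  where "log_ratio_integrand n k \<pi> \<pi>' \<theta> z =
    ext_ln (predictive M n k \<pi> z / predictive M n k \<pi>' z) * ereal (lik M {1..n + k} z \<theta>)"

lemma L_YX_eq:
  "L_YX M n k \<theta> \<pi> =
    ext_integral (sample_measure M (n + k)) (log_ratio_integrand n k (jeffreys_prior M) \<pi> \<theta>)"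
  by (simp add: L_YX_def log_ratio_integrand_def[abs_def])

lemma measurable_log_ratio_integrand_pair:
  assumes [measurable]: "prior M \<pi>" "prior M \<pi>'"
  shows "(\<lambda>p. log_ratio_integrand n k \<pi> \<pi>' (fst p) (snd p)) \<in>
    borel_measurable (param_space \<Otimes>\<^sub>M sample_measure M (n + k))"
proof -
  have [measurable]: "(\<lambda>p. lik M {1..n + k} (snd p) (fst p)) \<in>
      borel_measurable (param_space \<Otimes>\<^sub>M sample_measure M (n + k))"
    using measurable_pair_swap[OF measurable_lik_pair[OF order_refl, of "{1..n + k}"]]
    by (simp add: sample_measure_def split_beta')
  show ?thesis
    unfolding log_ratio_integrand_def by measurable
qed

lemma measurable_log_ratio_integrand [measurable]:
  assumes "prior M \<pi>" "prior M \<pi>'" "\<theta> \<in> params M"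
  shows "log_ratio_integrand n k \<pi> \<pi>' \<theta> \<in> borel_measurable (sample_measure M (n + k))"
  using measurable_Pair2[OF measurable_log_ratio_integrand_pair[OF assms(1,2)], of \<theta>] assms(3) by simp

lemma measurable_nn_integral_log_ratio:
  assumes "prior M \<pi>" "prior M \<pi>'" and [measurable]: "g \<in> borel_measurable borel"
  shows "(\<lambda>\<theta>. \<integral>\<^sup>+ z. g (log_ratio_integrand n k \<pi> \<pi>' \<theta> z) \<partial>sample_measure M (n + k))
    \<in> borel_measurable param_space"
proof -
  interpret S: sigma_finite_measure "sample_measure M (n + k)"
    unfolding sample_measure_def by (rule sigma_finite_PiM) simp
  note [measurable] = measurable_log_ratio_integrand_pair[OF assms(1,2)]
  show ?thesis
    by (rule S.borel_measurable_nn_integral) (simp add: split_beta')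
qed

lemma measurable_L_YX:
  assumes "prior M (jeffreys_prior M)" "prior M \<pi>"
  shows "(\<lambda>\<theta>. L_YX M n k \<theta> \<pi>) \<in> borel_measurable param_space"
  unfolding L_YX_eq ext_integral_def
  by (intro borel_measurable_ereal_diff measurable_compose[OF _ measurable_enn2ereal]
      measurable_nn_integral_log_ratio assms) measurable

section \<open>The expected ratio of two predictive densities\<close>

text \<open>By Tonelli the likelihood of Y integrates to one, which leaves the posterior mass
  \<open>marginal M n \<pi> x / marginal M n \<pi> x\<close>. This is 1 unless the marginal is 0 or
  \<infinity>, where the quotient is 0; hence only an inequality.\<close>

lemma nn_integral_posterior_predictive_le:
  assumes prior: "prior M \<pi>" and x: "x \<in> space (sample_measure M n)"
  shows "(\<integral>\<^sup>+ y. predictive M n k \<pi> (merge {1..n} {n+1..n+k} (x, y))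
    \<partial>Pi\<^sub>M {n+1..n+k} (\<lambda>_. base_measure M)) \<le> 1"
proof -
  let ?Y = "Pi\<^sub>M {n+1..n+k} (\<lambda>_. base_measure M)"
  have x': "x \<in> space (Pi\<^sub>M {1..n} (\<lambda>_. base_measure M))"
    using x by (simp add: sample_measure_def)
  note [measurable] = measurable_lik_param[OF x' order_refl prior]
  interpret Y: sigma_finite_measure ?Y
    by (rule sigma_finite_PiM) simp
  interpret P: sigma_finite_measure \<pi>
    by (rule sigma_finite_prior[OF prior])
  interpret pair_sigma_finite ?Y \<pi> ..
  have "(\<lambda>(y, \<theta>). ennreal (lik M {n+1..n+k} y \<theta>)) \<in> borel_measurable (?Y \<Otimes>\<^sub>M \<pi>)"
    by (rule measurable_lik_prior[OF order_refl prior])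
  then have [measurable]: "(\<lambda>p. ennreal (lik M {n+1..n+k} (fst p) (snd p))) \<in> borel_measurable (?Y \<Otimes>\<^sub>M \<pi>)"
    by (simp add: split_beta')
  let ?w = "\<lambda>\<theta>. ennreal (lik M {1..n} x \<theta>) / marginal M n \<pi> x"
  have "(\<integral>\<^sup>+ y. predictive M n k \<pi> (merge {1..n} {n+1..n+k} (x, y)) \<partial>?Y) =
      (\<integral>\<^sup>+ y. (\<integral>\<^sup>+ \<theta>. ?w \<theta> * ennreal (lik M {n+1..n+k} y \<theta>) \<partial>\<pi>) \<partial>?Y)"
  proof (rule nn_integral_cong)
    fix y assume y: "y \<in> space ?Y"
    note [measurable] = measurable_lik_param[OF y order_refl prior]
    show "predictive M n k \<pi> (merge {1..n} {n+1..n+k} (x, y)) =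
        (\<integral>\<^sup>+ \<theta>. ?w \<theta> * ennreal (lik M {n+1..n+k} y \<theta>) \<partial>\<pi>)"
      unfolding predictive_def posterior_def lik_merge marginal_merge
      by (rule nn_integral_density) measurable
  qed
  also have "\<dots> = (\<integral>\<^sup>+ \<theta>. (\<integral>\<^sup>+ y. ?w \<theta> * ennreal (lik M {n+1..n+k} y \<theta>) \<partial>?Y) \<partial>\<pi>)"
    by (rule Fubini'[symmetric]) (simp add: split_beta')
  also have "\<dots> = (\<integral>\<^sup>+ \<theta>. ?w \<theta> \<partial>\<pi>)"
  proof (rule nn_integral_cong)
    fix \<theta> assume "\<theta> \<in> space \<pi>"
    then have \<theta>: "\<theta> \<in> params M"
      by (simp add: space_prior[OF prior])
    have [measurable]: "(\<lambda>y. lik M {n+1..n+k} y \<theta>) \<in> borel_measurable ?Y"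
      by (rule measurable_lik order_refl \<theta>)+
    show "(\<integral>\<^sup>+ y. ?w \<theta> * ennreal (lik M {n+1..n+k} y \<theta>) \<partial>?Y) = ?w \<theta>"
      by (subst nn_integral_cmult) (simp_all add: nn_integral_lik \<theta>)
  qed
  also have "\<dots> = marginal M n \<pi> x / marginal M n \<pi> x"
    unfolding marginal_def by (rule nn_integral_divide) measurable
  also have "\<dots> \<le> 1"
    by (cases "marginal M n \<pi> x = 0 \<or> marginal M n \<pi> x = \<top>")
      (auto simp: ennreal_divide_self less_top)
  finally show ?thesis .
qed

lemma nn_integral_marginal:
  assumes "prior M \<tau>" "prob_space \<tau>"
  shows "(\<integral>\<^sup>+ x. marginal M n \<tau> x \<partial>sample_measure M n) = 1"
proof -
  interpret prob_space \<tau> by fact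
  interpret S: sigma_finite_measure "sample_measure M n"
    unfolding sample_measure_def by (rule sigma_finite_PiM) simp
  interpret pair_sigma_finite "sample_measure M n" \<tau> ..
  have "(\<integral>\<^sup>+ x. marginal M n \<tau> x \<partial>sample_measure M n) =
      (\<integral>\<^sup>+ \<theta>. (\<integral>\<^sup>+ x. ennreal (lik M {1..n} x \<theta>) \<partial>sample_measure M n) \<partial>\<tau>)"
    unfolding marginal_def
    using measurable_lik_prior[OF order_refl assms(1), of "{1..n}"]
    by (intro Fubini'[symmetric]) (simp add: sample_measure_def)
  also have "\<dots> = (\<integral>\<^sup>+ \<theta>. 1 \<partial>\<tau>)"
    by (intro nn_integral_cong) (simp add: sample_measure_def nn_integral_lik space_prior[OF assms(1)])
  finally show ?thesis
    by (simp add: emeasure_space_1)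
qed

text \<open>Under the joint law of parameter and data, the data have density \<open>marginal\<close>, so the ratio
  integrates a posterior predictive density over \<open>y\<close>.\<close>

lemma expected_predictive_ratio_le:
  assumes \<tau>: "prior M \<tau>" "prob_space \<tau>" and \<pi>: "prior M \<pi>"
  shows "(\<integral>\<^sup>+ \<theta>. (\<integral>\<^sup>+ z. predictive M n k \<pi> z / predictive M n k \<tau> z * ennreal (lik M {1..n + k} z \<theta>)
    \<partial>sample_measure M (n + k)) \<partial>\<tau>) \<le> 1"
proof -
  interpret prob_space \<tau> by fact
  interpret S: sigma_finite_measure "sample_measure M (n + k)"
    unfolding sample_measure_def by (rule sigma_finite_PiM) simp
  interpret pair_sigma_finite "sample_measure M (n + k)" \<tau> ..
  let ?Y = "Pi\<^sub>M {n+1..n+k} (\<lambda>_. base_measure M)"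
  let ?R = "\<lambda>z. predictive M n k \<pi> z / predictive M n k \<tau> z"
  let ?z = "\<lambda>x y. merge {1..n} {n+1..n+k} (x, y)"
  note [measurable] = measurable_predictive[OF \<tau>(1)] measurable_predictive[OF \<pi>]
  have *: "{1..n + k} = {1..n} \<union> {n+1..n+k}"
    by auto
  have merge_meas: "(\<lambda>p. merge {1..n} {n+1..n+k} p) \<in> sample_measure M n \<Otimes>\<^sub>M ?Y \<rightarrow>\<^sub>M sample_measure M (n + k)"
    unfolding sample_measure_def * by (rule measurable_merge)
  have [measurable]: "marginal M i \<tau> \<in> borel_measurable (sample_measure M j)" if "i \<le> j" for i j
    unfolding sample_measure_def by (rule measurable_marginal) (use \<tau> that in auto)
  have "(\<lambda>(z, \<theta>). ennreal (lik M {1..n + k} z \<theta>)) \<in> borel_measurable (sample_measure M (n + k) \<Otimes>\<^sub>M \<tau>)"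
    unfolding sample_measure_def by (rule measurable_lik_prior[OF order_refl \<tau>(1)])
  then have [measurable]: "(\<lambda>p. ennreal (lik M {1..n + k} (fst p) (snd p)))
      \<in> borel_measurable (sample_measure M (n + k) \<Otimes>\<^sub>M \<tau>)"
    by (simp add: split_beta')
  have "(\<integral>\<^sup>+ \<theta>. (\<integral>\<^sup>+ z. ?R z * ennreal (lik M {1..n + k} z \<theta>) \<partial>sample_measure M (n + k)) \<partial>\<tau>) =
      (\<integral>\<^sup>+ z. (\<integral>\<^sup>+ \<theta>. ?R z * ennreal (lik M {1..n + k} z \<theta>) \<partial>\<tau>) \<partial>sample_measure M (n + k))"
    by (rule Fubini') (simp add: split_beta')
  also have "\<dots> = (\<integral>\<^sup>+ z. ?R z * marginal M (n + k) \<tau> z \<partial>sample_measure M (n + k))"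
  proof (rule nn_integral_cong)
    fix z assume z: "z \<in> space (sample_measure M (n + k))"
    have [measurable]: "(\<lambda>\<theta>. ennreal (lik M {1..n + k} z \<theta>)) \<in> borel_measurable \<tau>"
      using z unfolding sample_measure_def by (rule measurable_lik_param[OF _ order_refl \<tau>(1)])
    show "(\<integral>\<^sup>+ \<theta>. ?R z * ennreal (lik M {1..n + k} z \<theta>) \<partial>\<tau>) = ?R z * marginal M (n + k) \<tau> z"
      unfolding marginal_def by (rule nn_integral_cmult) measurable
  qed
  also have "\<dots> = (\<integral>\<^sup>+ x. (\<integral>\<^sup>+ y. ?R (?z x y) * marginal M (n + k) \<tau> (?z x y) \<partial>?Y) \<partial>sample_measure M n)"
    by (rule nn_integral_sample_split) measurable
  \<comment> \<open>For fixed \<open>x\<close> the joint marginal cancels the denominator of the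
    ratio, leaving the marginal of \<open>x\<close> times the predictive density of \<pi>, whose
    integral over \<open>y\<close> is at most one. The marginal of \<open>x\<close> is almost
    everywhere finite because it integrates to one.\<close>
  also have "\<dots> \<le> (\<integral>\<^sup>+ x. marginal M n \<tau> x \<partial>sample_measure M n)"
  proof (rule nn_integral_mono_AE)
    have "AE x in sample_measure M n. marginal M n \<tau> x \<noteq> \<infinity>"
      by (rule nn_integral_PInf_AE) (simp_all add: nn_integral_marginal[OF \<tau>])
    then show "AE x in sample_measure M n.
        (\<integral>\<^sup>+ y. ?R (?z x y) * marginal M (n + k) \<tau> (?z x y) \<partial>?Y) \<le> marginal M n \<tau> x"
    proof (rule AE_mp, intro AE_I2 impI)
      fix x assume x: "x \<in> space (sample_measure M n)" and fin: "marginal M n \<tau> x \<noteq> \<infinity>"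
      have x': "x \<in> space (Pi\<^sub>M {1..n} (\<lambda>_. base_measure M))"
        using x by (simp add: sample_measure_def)
      have z: "?z x y \<in> space (Pi\<^sub>M {1..n + k} (\<lambda>_. base_measure M))" if "y \<in> space ?Y" for y
        using measurable_space[OF merge_meas, of "(x, y)"] x that
        by (simp add: space_pair_measure sample_measure_def)
      have "(\<integral>\<^sup>+ y. ?R (?z x y) * marginal M (n + k) \<tau> (?z x y) \<partial>?Y) \<le>
          (\<integral>\<^sup>+ y. marginal M n \<tau> x * predictive M n k \<pi> (?z x y) \<partial>?Y)"
      proof (rule nn_integral_mono)
        fix y assume y: "y \<in> space ?Y"
        have pred: "predictive M n k \<tau> (?z x y) = marginal M (n + k) \<tau> (?z x y) / marginal M n \<tau> x"
          using predictive_eq[OF \<tau>(1) order_refl z[OF y]] by (simp only: marginal_merge)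
        \<comment> \<open>If the marginal of \<open>x\<close> vanishes, the likelihood of
          \<open>x\<close> is zero for \<tau>-almost every parameter, and so is its product with the
          likelihood of \<open>y\<close>.\<close>
        have zero: "marginal M (n + k) \<tau> (?z x y) = 0" if "marginal M n \<tau> x = 0"
        proof -
          have [measurable]: "(\<lambda>\<theta>. ennreal (lik M {1..n} x \<theta>)) \<in> borel_measurable \<tau>"
            "(\<lambda>\<theta>. ennreal (lik M {1..n + k} (?z x y) \<theta>)) \<in> borel_measurable \<tau>"
            by (rule measurable_lik_param[OF x' order_refl \<tau>(1)]
                measurable_lik_param[OF z[OF y] order_refl \<tau>(1)])+
          have "AE \<theta> in \<tau>. ennreal (lik M {1..n} x \<theta>) = 0"
            using that unfolding marginal_def by (subst (asm) nn_integral_0_iff_AE) auto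
          moreover have "AE \<theta> in \<tau>. 0 \<le> lik M {1..n} x \<theta>"
            by (rule AE_I2) (simp add: lik_nonneg[OF x' order_refl] space_prior[OF \<tau>(1)])
          ultimately have "AE \<theta> in \<tau>. ennreal (lik M {1..n + k} (?z x y) \<theta>) = 0"
            by eventually_elim (simp add: lik_append lik_merge)
          then show ?thesis
            unfolding marginal_def by (subst nn_integral_0_iff_AE) auto
        qed
        define a b c where "a = marginal M n \<tau> x" and "b = marginal M (n + k) \<tau> (?z x y)"
          and "c = predictive M n k \<pi> (?z x y)"
        \<comment> \<open>Cancellation is exact when \<open>a\<close> and \<open>b\<close> are
          positive and finite. If \<open>b\<close> is 0 or \<infinity> the left side is 0, and
          \<open>a = 0\<close> forces \<open>b = 0\<close>.\<close>
        have "c / (b / a) * b \<le> a * c"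
        proof (cases "a = 0 \<or> b = 0 \<or> b = \<top>")
          case True
          then show ?thesis
            using zero fin by (auto simp: a_def b_def ennreal_top_divide)
        next
          case False
          then have "c / (b / a) * b = a * c"
            using fin unfolding a_def[symmetric]
            by (cases a; cases b; cases c)
              (auto simp: divide_ennreal ennreal_top_divide ennreal_mult_top ennreal_top_mult simp flip: ennreal_mult)
          then show ?thesis
            by simp
        qed
        then show "?R (?z x y) * marginal M (n + k) \<tau> (?z x y) \<le>
            marginal M n \<tau> x * predictive M n k \<pi> (?z x y)"
          unfolding pred a_def b_def c_def .
      qed
      also have "\<dots> = marginal M n \<tau> x * (\<integral>\<^sup>+ y. predictive M n k \<pi> (?z x y) \<partial>?Y)"
        using measurable_Pair2[OF measurable_compose[OF merge_meas measurable_predictive[OF \<pi>]], of x] x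
        by (intro nn_integral_cmult) simp
      also have "\<dots> \<le> marginal M n \<tau> x * 1"
        by (intro mult_left_mono nn_integral_posterior_predictive_le[OF \<pi> x]) simp
      finally show "(\<integral>\<^sup>+ y. ?R (?z x y) * marginal M (n + k) \<tau> (?z x y) \<partial>?Y) \<le> marginal M n \<tau> x"
        by simp
    qed
  qed
  also have "\<dots> = 1"
    by (rule nn_integral_marginal[OF \<tau>])
  finally show ?thesis .
qed

end

section \<open>Bayes optimality of a proper prior\<close>

text \<open>The inequality ln t \<le> t - 1 at t = b/a, multiplied by \<open>y\<close> and arranged
  between nonnegative terms. The second form drops the term \<open>y\<close>; it bounds the negative
  part of the log ratio by something integrable.\<close>

lemma neg_ln_parts_le:
  fixes a b l :: ennreal
  assumes a: "0 < a" "a < \<infinity>" and b: "0 < b" "b < \<infinity>" and y: "0 < y"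
  shows "e2ennreal (- (ext_ln (a / b) * ereal y)) + ennreal y \<le>
      e2ennreal (ext_ln (a / b) * ereal y) + b / a * ennreal y"
    and "e2ennreal (- (ext_ln (a / b) * ereal y)) \<le> b / a * ennreal y"
proof -
  obtain r s where r: "a = ennreal r" "0 < r" and s: "b = ennreal s" "0 < s"
    using a b by (cases a; cases b) auto
  have ln: "ext_ln (a / b) = ereal (ln (r / s))"
    using r s by (simp add: ext_ln_def divide_ennreal not_le)
  have quot: "b / a * ennreal y = ennreal (s / r * y)"
    using r s y by (simp add: divide_ennreal flip: ennreal_mult)
  have "ln (s / r) \<le> s / r - 1"
    using r s by (intro ln_le_minus_one) simp
  then have "- ln (r / s) * y \<le> (s / r - 1) * y"
    using r s y by (intro mult_right_mono) (simp_all add: ln_div)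
  then have le: "y \<le> ln (r / s) * y + s / r * y"
    by (simp add: algebra_simps)
  have pos: "0 < s / r * y"
    using r s y by simp
  show "e2ennreal (- (ext_ln (a / b) * ereal y)) + ennreal y \<le>
      e2ennreal (ext_ln (a / b) * ereal y) + b / a * ennreal y"
  proof (cases "0 \<le> ln (r / s) * y")
    case True
    then show ?thesis
      using le pos y unfolding ln quot
      by (simp add: ennreal_neg ennreal_leI flip: ennreal_plus)
  next
    case False
    then show ?thesis
      using le pos y unfolding ln quot
      by (simp add: ennreal_neg ennreal_leI flip: ennreal_plus)
  qed
  show "e2ennreal (- (ext_ln (a / b) * ereal y)) \<le> b / a * ennreal y"
    using le y unfolding ln quot by (simp add: ennreal_leI)
qed

text \<open>This is log (c/a) = log (c/b) + log (b/a), with the last term written as negative minus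
  positive part of log (a/b), the form that \<open>ext_integral_le_add\<close> requires.\<close>

lemma ext_ln_diff:
  fixes a b c :: ennreal
  assumes a: "0 < a" "a < \<infinity>" and b: "0 < b" "b < \<infinity>" and c: "0 < c" "c < \<infinity>"
  shows "ext_ln (c / a) * ereal y = ext_ln (c / b) * ereal y +
    (enn2ereal (e2ennreal (- (ext_ln (a / b) * ereal y))) -
     enn2ereal (e2ennreal (ext_ln (a / b) * ereal y)))"
proof -
  obtain r s t where r: "a = ennreal r" "0 < r" and s: "b = ennreal s" "0 < s"
    and t: "c = ennreal t" "0 < t"
    using a b c by (cases a; cases b; cases c) auto
  have "ext_ln (a / b) = ereal (ln r - ln s)" "ext_ln (c / a) = ereal (ln t - ln r)"
    "ext_ln (c / b) = ereal (ln t - ln s)"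
    using r s t by (simp_all add: ext_ln_def divide_ennreal not_le ln_div)
  then show ?thesis
    by (cases "0 \<le> (ln r - ln s) * y") (auto simp: ennreal_neg zero_ennreal.rep_eq algebra_simps)
qed

context statistical_model
begin

text \<open>Jeffreys' predictive density cancels in the difference of the two regrets, leaving
  \<open>G - F\<close>. Averaging \<open>G + 1 \<le> F + Q\<close> over \<tau>, with
  \<open>Q\<close> of mean at most one, yields that \<open>G\<close> has integral at most that of
  \<open>F\<close>. The cruder bound \<open>G \<le> Q\<close> comes first: it makes the integral of
  \<open>G\<close> finite, so that \<open>ext_integral_le_add\<close> applies even if
  \<open>F\<close> has infinite integral.\<close>

lemma L_YX_avg_self_le:
  assumes \<tau>: "\<tau> \<in> Pi_inf M" "prob_space \<tau>" and \<pi>: "\<pi> \<in> Pi_inf M"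
    and J: "jeffreys_prior M \<in> Pi_inf M" and n: "n \<ge> 1"
  shows "L_YX_avg M n k \<tau> \<tau> \<le> L_YX_avg M n k \<tau> \<pi>"
proof -
  interpret prob_space \<tau> by fact
  let ?S = "sample_measure M (n + k)"
  let ?l = "\<lambda>\<theta> z. lik M {1..n + k} z \<theta>"
  let ?R = "\<lambda>z. predictive M n k \<pi> z / predictive M n k \<tau> z"
  have prior: "prior M \<tau>" "prior M \<pi>" "prior M (jeffreys_prior M)"
    using \<tau> \<pi> J by (simp_all add: Pi_inf_def Pi_class_def)
  \<comment> \<open>\<open>F\<close> and \<open>G\<close> are the expected positive and negative
    parts of the log ratio of the predictive densities of \<tau> and \<pi> at a fixed parameter, and
    \<open>Q\<close> is the expectation of the inverse ratio.\<close>
  define F where "F \<theta> = (\<integral>\<^sup>+ z. e2ennreal (log_ratio_integrand n k \<tau> \<pi> \<theta> z) \<partial>?S)" for \<theta>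
  define G where "G \<theta> = (\<integral>\<^sup>+ z. e2ennreal (- log_ratio_integrand n k \<tau> \<pi> \<theta> z) \<partial>?S)" for \<theta>
  define Q where "Q \<theta> = (\<integral>\<^sup>+ z. ?R z * ennreal (?l \<theta> z) \<partial>?S)" for \<theta>
  interpret S: sigma_finite_measure ?S
    unfolding sample_measure_def by (rule sigma_finite_PiM) simp
  note [measurable] = measurable_predictive[OF prior(1)] measurable_predictive[OF prior(2)]
  have [measurable]: "F \<in> borel_measurable \<tau>" "G \<in> borel_measurable \<tau>"
    unfolding F_def G_def measurable_cong_sets[OF prior_cong[OF prior(1)] refl]
    by (intro measurable_nn_integral_log_ratio prior; measurable)+
  have "(\<lambda>p. lik M {1..n + k} (snd p) (fst p)) \<in> borel_measurable (param_space \<Otimes>\<^sub>M ?S)"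
    using measurable_pair_swap[OF measurable_lik_pair[OF order_refl, of "{1..n + k}"]]
    by (simp add: sample_measure_def split_beta')
  then have "Q \<in> borel_measurable param_space"
    unfolding Q_def by (intro S.borel_measurable_nn_integral) (simp add: split_beta')
  then have [measurable]: "Q \<in> borel_measurable \<tau>"
    using measurable_cong_sets[OF prior_cong[OF prior(1)] refl] by blast
  have Q_le: "(\<integral>\<^sup>+ \<theta>. Q \<theta> \<partial>\<tau>) \<le> 1"
    unfolding Q_def by (rule expected_predictive_ratio_le[OF prior(1) \<tau>(2) prior(2)])

  have pointwise: "G \<theta> + 1 \<le> F \<theta> + Q \<theta>" "G \<theta> \<le> Q \<theta>"
    "G \<theta> < \<infinity> \<Longrightarrow> L_YX M n k \<theta> \<tau> \<le> L_YX M n k \<theta> \<pi> + (enn2ereal (G \<theta>) - enn2ereal (F \<theta>))"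
    if \<theta>: "\<theta> \<in> params M" for \<theta>
  proof -
    note [measurable] = measurable_log_ratio_integrand[OF prior(1,2) \<theta>]
      measurable_log_ratio_integrand[OF prior(3,1) \<theta>] measurable_log_ratio_integrand[OF prior(3,2) \<theta>]
    have [measurable]: "?l \<theta> \<in> borel_measurable ?S"
      unfolding sample_measure_def by (rule measurable_lik order_refl \<theta>)+
    have nonneg: "AE z in ?S. 0 \<le> ?l \<theta> z"
      unfolding sample_measure_def by (intro AE_I2 lik_nonneg[OF _ order_refl \<theta>])
    have lik_1: "(\<integral>\<^sup>+ z. ennreal (?l \<theta> z) \<partial>?S) = 1"
      unfolding sample_measure_def by (simp add: nn_integral_lik \<theta>)
    note regular = nonneg predictive_regular[OF \<tau>(1) \<theta> n, of k] predictive_regular[OF \<pi> \<theta> n, of k]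
    have le: "AE z in ?S.
        e2ennreal (- log_ratio_integrand n k \<tau> \<pi> \<theta> z) + ennreal (?l \<theta> z) \<le>
          e2ennreal (log_ratio_integrand n k \<tau> \<pi> \<theta> z) + ?R z * ennreal (?l \<theta> z) \<and>
        e2ennreal (- log_ratio_integrand n k \<tau> \<pi> \<theta> z) \<le> ?R z * ennreal (?l \<theta> z)"
      using regular
    proof eventually_elim
      case (elim z)
      show ?case
      proof (cases "?l \<theta> z = 0")
        case True
        then show ?thesis
          by (simp add: log_ratio_integrand_def flip: zero_ereal_def)
      next
        case False
        then show ?thesis
          using elim unfolding log_ratio_integrand_def by (intro conjI neg_ln_parts_le) auto
      qed
    qed
    have "(\<integral>\<^sup>+ z. e2ennreal (- log_ratio_integrand n k \<tau> \<pi> \<theta> z) + ennreal (?l \<theta> z) \<partial>?S) \<le>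
        (\<integral>\<^sup>+ z. e2ennreal (log_ratio_integrand n k \<tau> \<pi> \<theta> z) + ?R z * ennreal (?l \<theta> z) \<partial>?S)"
      by (rule nn_integral_mono_AE) (use le in auto)
    then show "G \<theta> + 1 \<le> F \<theta> + Q \<theta>"
      by (simp add: nn_integral_add lik_1 F_def G_def Q_def)
    show "G \<theta> \<le> Q \<theta>"
      unfolding G_def Q_def by (rule nn_integral_mono_AE) (use le in auto)
    assume fin: "G \<theta> < \<infinity>"
    have "AE z in ?S. log_ratio_integrand n k (jeffreys_prior M) \<tau> \<theta> z =
        log_ratio_integrand n k (jeffreys_prior M) \<pi> \<theta> z +
          (enn2ereal (e2ennreal (- log_ratio_integrand n k \<tau> \<pi> \<theta> z)) -
           enn2ereal (e2ennreal (log_ratio_integrand n k \<tau> \<pi> \<theta> z)))"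
      using regular predictive_regular[OF J \<theta> n, of k]
    proof eventually_elim
      case (elim z)
      show ?case
      proof (cases "?l \<theta> z = 0")
        case True
        then show ?thesis
          by (simp add: log_ratio_integrand_def zero_ennreal.rep_eq flip: zero_ereal_def)
      next
        case False
        then show ?thesis
          using elim unfolding log_ratio_integrand_def by (intro ext_ln_diff) auto
      qed
    qed
    then have ae: "AE z in ?S. log_ratio_integrand n k (jeffreys_prior M) \<tau> \<theta> z \<le>
        log_ratio_integrand n k (jeffreys_prior M) \<pi> \<theta> z +
          (enn2ereal (e2ennreal (- log_ratio_integrand n k \<tau> \<pi> \<theta> z)) -
           enn2ereal (e2ennreal (log_ratio_integrand n k \<tau> \<pi> \<theta> z)))"
      by (rule eventually_mono) simp
    show "L_YX M n k \<theta> \<tau> \<le> L_YX M n k \<theta> \<pi> + (enn2ereal (G \<theta>) - enn2ereal (F \<theta>))"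
      using fin unfolding L_YX_eq F_def G_def by (intro ext_integral_le_add ae) measurable
  qed

  have "(\<integral>\<^sup>+ \<theta>. G \<theta> \<partial>\<tau>) \<le> (\<integral>\<^sup>+ \<theta>. Q \<theta> \<partial>\<tau>)"
    using pointwise(2) by (intro nn_integral_mono) (simp add: space_prior[OF prior(1)])
  then have G_fin: "(\<integral>\<^sup>+ \<theta>. G \<theta> \<partial>\<tau>) < \<infinity>"
    using Q_le by (auto simp: less_top[symmetric] top_unique)
  have "(\<integral>\<^sup>+ \<theta>. G \<theta> + 1 \<partial>\<tau>) \<le> (\<integral>\<^sup>+ \<theta>. F \<theta> + Q \<theta> \<partial>\<tau>)"
    using pointwise(1) by (intro nn_integral_mono) (simp add: space_prior[OF prior(1)])
  then have "(\<integral>\<^sup>+ \<theta>. G \<theta> \<partial>\<tau>) + 1 \<le> (\<integral>\<^sup>+ \<theta>. F \<theta> \<partial>\<tau>) + (\<integral>\<^sup>+ \<theta>. Q \<theta> \<partial>\<tau>)"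
    by (simp add: nn_integral_add emeasure_space_1)
  also have "\<dots> \<le> (\<integral>\<^sup>+ \<theta>. F \<theta> \<partial>\<tau>) + 1"
    using Q_le by (rule add_left_mono)
  finally have G_le_F: "(\<integral>\<^sup>+ \<theta>. G \<theta> \<partial>\<tau>) \<le> (\<integral>\<^sup>+ \<theta>. F \<theta> \<partial>\<tau>)"
    by (simp add: ennreal_add_left_cancel_le add.commute[of _ 1])

  have [measurable]: "(\<lambda>\<theta>. L_YX M n k \<theta> \<tau>) \<in> borel_measurable \<tau>"
    "(\<lambda>\<theta>. L_YX M n k \<theta> \<pi>) \<in> borel_measurable \<tau>"
    unfolding measurable_cong_sets[OF prior_cong[OF prior(1)] refl]
    by (rule measurable_L_YX prior)+
  have "AE \<theta> in \<tau>. G \<theta> \<noteq> \<infinity>"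
    by (rule nn_integral_PInf_AE) (use G_fin in auto)
  moreover have "AE \<theta> in \<tau>. \<theta> \<in> params M"
    by (rule AE_I2) (simp add: space_prior[OF prior(1)])
  ultimately have "AE \<theta> in \<tau>. L_YX M n k \<theta> \<tau> \<le>
      L_YX M n k \<theta> \<pi> + (enn2ereal (G \<theta>) - enn2ereal (F \<theta>))"
    by eventually_elim (simp add: pointwise(3) less_top)
  then have "L_YX_avg M n k \<tau> \<tau> \<le> L_YX_avg M n k \<tau> \<pi> +
      (enn2ereal (\<integral>\<^sup>+ \<theta>. G \<theta> \<partial>\<tau>) - enn2ereal (\<integral>\<^sup>+ \<theta>. F \<theta> \<partial>\<tau>))"
    unfolding L_YX_avg_def using G_fin by (intro ext_integral_le_add) measurable
  also have "\<dots> \<le> L_YX_avg M n k \<tau> \<pi> + 0"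
    using G_le_F G_fin
    by (intro add_left_mono)
      (cases "\<integral>\<^sup>+ \<theta>. G \<theta> \<partial>\<tau>"; cases "\<integral>\<^sup>+ \<theta>. F \<theta> \<partial>\<tau>"; auto simp: ennreal_le_iff)
  finally show ?thesis
    by simp
qed

lemma L_self_le:
  assumes "\<tau> \<in> Pi_inf M" "prob_space \<tau>" "\<pi> \<in> Pi_inf M" "jeffreys_prior M \<in> Pi_inf M"
  shows "L M m \<tau> \<tau> \<le> L M m \<tau> \<pi>"
  unfolding L_def
proof (rule Limsup_mono, rule eventually_sequentiallyI[of 1])
  fix n :: nat assume "1 \<le> n"
  then show "ereal (c_seq m n) * L_YX_avg M n (m n) \<tau> \<tau> \<le> ereal (c_seq m n) * L_YX_avg M n (m n) \<tau> \<pi>"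
    by (intro ereal_mult_left_mono L_YX_avg_self_le assms) (simp_all add: c_seq_def)
qed

section \<open>Uniform bounds on the scaled regret and the limit of its averages\<close>

lemma c_seq_pos: "1 \<le> n \<Longrightarrow> 0 < m n \<Longrightarrow> 0 < c_seq m n"
  by (simp add: c_seq_def)

lemma L_point_eq:
  assumes "prior M (jeffreys_prior M)" "prior M \<pi>" "\<theta> \<in> params M"
  shows "L_point M m \<theta> \<pi> = limsup (\<lambda>n. ereal (c_seq m n) * L_YX M n (m n) \<theta> \<pi>)"
  unfolding L_point_def L_def L_YX_avg_def
  using assms by (simp add: ext_integral_return measurable_L_YX)

text \<open>Supplies the upper bound, uniform in the parameter, that the reverse Fatou inequality
  needs. Positivity of \<open>c_seq m n\<close> allows the factor to be compared inside and outside
  the supremum.\<close>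

lemma U_class_bound:
  assumes U: "\<pi> \<in> U_class M" and m: "\<forall>n\<ge>1. 0 < m n"
  obtains B where "\<forall>\<^sub>F n in sequentially.
    \<forall>\<theta>\<in>params M. ereal (c_seq m n) * L_YX M n (m n) \<theta> \<pi> \<le> ereal B"
proof -
  have "limsup (\<lambda>n. ereal (c_seq m n) * (SUP \<theta>\<in>params M. L_YX M n (m n) \<theta> \<pi>)) < \<infinity>"
    using U m by (simp add: U_class_def)
  then obtain B :: real
    where "limsup (\<lambda>n. ereal (c_seq m n) * (SUP \<theta>\<in>params M. L_YX M n (m n) \<theta> \<pi>)) < ereal B"
    using ereal_dense2 by blast
  then have "\<forall>\<^sub>F n in sequentially.
      ereal (c_seq m n) * (SUP \<theta>\<in>params M. L_YX M n (m n) \<theta> \<pi>) < ereal B"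
    by (rule Limsup_lessD)
  moreover have "\<forall>\<^sub>F n in sequentially. 0 < c_seq m n"
    by (rule eventually_sequentiallyI[of 1]) (simp add: c_seq_pos m)
  ultimately have "\<forall>\<^sub>F n in sequentially.
      \<forall>\<theta>\<in>params M. ereal (c_seq m n) * L_YX M n (m n) \<theta> \<pi> \<le> ereal B"
  proof eventually_elim
    case (elim n)
    show ?case
    proof
      fix \<theta> assume "\<theta> \<in> params M"
      then have "ereal (c_seq m n) * L_YX M n (m n) \<theta> \<pi> \<le>
          ereal (c_seq m n) * (SUP \<theta>\<in>params M. L_YX M n (m n) \<theta> \<pi>)"
        using elim by (intro ereal_mult_left_mono SUP_upper) simp_all
      with elim show "ereal (c_seq m n) * L_YX M n (m n) \<theta> \<pi> \<le> ereal B"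
        by simp
    qed
  qed
  then show thesis
    by (rule that)
qed

text \<open>The factor \<open>c_seq m n\<close> is moved into the average over \<tau>; then
  \<open>limsup_ext_integral_le\<close> exchanges limit superior and average in the direction
  required.\<close>

lemma L_le_equalizer_value:
  assumes U: "\<pi> \<in> U_class M" and m: "\<forall>n\<ge>1. 0 < m n"
    and J: "prior M (jeffreys_prior M)" and \<tau>: "prior M \<tau>" "prob_space \<tau>"
    and le: "\<And>\<theta>. \<theta> \<in> params M \<Longrightarrow> L_point M m \<theta> \<pi> \<le> ereal c"
  shows "L M m \<tau> \<pi> \<le> ereal c"
proof -
  have \<pi>: "prior M \<pi>"
    using U by (simp add: U_class_def Pi_inf_def Pi_class_def)
  have [measurable]: "(\<lambda>\<theta>. L_YX M n k \<theta> \<pi>) \<in> borel_measurable \<tau>" for n k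
    unfolding measurable_cong_sets[OF prior_cong[OF \<tau>(1)] refl] by (rule measurable_L_YX[OF J \<pi>])
  obtain B where B: "\<forall>\<^sub>F n in sequentially.
      \<forall>\<theta>\<in>params M. ereal (c_seq m n) * L_YX M n (m n) \<theta> \<pi> \<le> ereal B"
    using U_class_bound[OF U m] .
  have "\<forall>\<^sub>F n in sequentially. ereal (c_seq m n) * L_YX_avg M n (m n) \<tau> \<pi> =
      ext_integral \<tau> (\<lambda>\<theta>. ereal (c_seq m n) * L_YX M n (m n) \<theta> \<pi>)"
    unfolding L_YX_avg_def
    by (rule eventually_sequentiallyI[of 1]) (simp add: ext_integral_cmult c_seq_pos m)
  then have "L M m \<tau> \<pi> =
      limsup (\<lambda>n. ext_integral \<tau> (\<lambda>\<theta>. ereal (c_seq m n) * L_YX M n (m n) \<theta> \<pi>))"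
    unfolding L_def by (rule Limsup_eq)
  also have "\<dots> \<le> ereal c"
  proof (rule limsup_ext_integral_le[OF \<tau>(2)])
    show "\<forall>\<^sub>F n in sequentially.
        \<forall>\<theta>\<in>space \<tau>. ereal (c_seq m n) * L_YX M n (m n) \<theta> \<pi> \<le> ereal B"
      using B by (simp add: space_prior[OF \<tau>(1)])
    show "limsup (\<lambda>n. ereal (c_seq m n) * L_YX M n (m n) \<theta> \<pi>) \<le> ereal c" if "\<theta> \<in> space \<tau>" for \<theta>
      using le[of \<theta>] that by (simp add: L_point_eq[OF J \<pi>] space_prior[OF \<tau>(1)])
  qed measurable
  finally show ?thesis .
qed

section \<open>Equalizer priors and their approximating sequences\<close>

lemma PhiD:
  assumes "\<tau> \<in> Phi M m"
  shows "\<tau> \<in> Pi_inf M" "prior M \<tau>" "prob_space \<tau>" "zeta M m \<tau> < \<infinity>"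
  using assms by (simp_all add: Phi_def Pi_inf_def Pi_class_def Omega_inf_def Omega_class_def)

text \<open>Condition (i) expresses the regret as an average of pointwise limits, here the average
  of a constant under a probability measure.\<close>

lemma L_approximating_sequence:
  assumes seq: "approximating_sequence M m \<pi> \<tau>"
    and eq: "\<And>\<theta>. \<theta> \<in> params M \<Longrightarrow> L_point M m \<theta> \<pi> = c"
  shows "L M m (\<tau> k) \<pi> = c"
proof -
  have "\<tau> k \<in> Phi M m"
    using seq by (simp add: approximating_sequence_def)
  then have "ext_integral (\<tau> k) (\<lambda>\<theta>. L_point M m \<theta> \<pi>) = c"
    by (intro ext_integral_const) (auto dest: PhiD simp: space_prior eq)
  then show ?thesis
    using seq by (simp add: approximating_sequence_def)
qed

text \<open>The bound from \<open>U_class\<close> at a single parameter excludes \<infinity>. The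
  value -\<infinity> would make \<open>d_pred\<close> equal to -\<infinity> along the whole
  sequence, as \<open>zeta\<close> is below \<infinity> on \<open>Phi\<close>, and this contradicts
  convergence to 0.\<close>

lemma equalizer_value_finite:
  assumes seq: "approximating_sequence M m \<pi> \<tau>" and U: "\<pi> \<in> U_class M" and m: "\<forall>n\<ge>1. 0 < m n"
    and J: "prior M (jeffreys_prior M)"
    and eq: "\<And>\<theta>. \<theta> \<in> params M \<Longrightarrow> L_point M m \<theta> \<pi> = c"
  shows "\<bar>c\<bar> \<noteq> \<infinity>"
proof -
  have \<pi>: "prior M \<pi>"
    using U by (simp add: U_class_def Pi_inf_def Pi_class_def)
  have \<Phi>: "\<tau> k \<in> Phi M m" for k
    using seq by (simp add: approximating_sequence_def)
  interpret prob_space "\<tau> 0"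
    by (rule PhiD[OF \<Phi>])
  \<comment> \<open>The parameter set is nonempty because it carries the probability measure
    \<open>\<tau> 0\<close>.\<close>
  obtain \<theta> where \<theta>: "\<theta> \<in> params M"
    using not_empty space_prior[OF PhiD(2)[OF \<Phi>]] by blast
  obtain B where B: "\<forall>\<^sub>F n in sequentially.
      \<forall>\<theta>\<in>params M. ereal (c_seq m n) * L_YX M n (m n) \<theta> \<pi> \<le> ereal B"
    using U_class_bound[OF U m] .
  have "c \<le> ereal B"
    unfolding eq[OF \<theta>, symmetric] L_point_eq[OF J \<pi> \<theta>]
    by (rule Limsup_bounded) (use B \<theta> in \<open>auto elim: eventually_mono\<close>)
  moreover have "c \<noteq> - \<infinity>"
  proof
    assume "c = - \<infinity>"
    then have "d_pred M m (\<tau> k) \<pi> = - \<infinity>" for k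
      using L_approximating_sequence[OF seq eq, of k] PhiD(4)[OF \<Phi>, of k]
      by (simp add: d_pred_def)
    then have "(\<lambda>k::nat. - \<infinity> :: ereal) \<longlonglongrightarrow> 0"
      using seq by (simp add: approximating_sequence_def)
    then show False
      by (simp add: tendsto_const_iff)
  qed
  ultimately show ?thesis
    by auto
qed

text \<open>Along the sequence \<open>d_pred\<close> is \<open>c\<close> plus \<open>zeta\<close>;
  since \<open>c\<close> is real it can be subtracted from a limit in the extended reals.\<close>

lemma zeta_approximating_sequence_tendsto:
  assumes seq: "approximating_sequence M m \<pi> \<tau>"
    and eq: "\<And>\<theta>. \<theta> \<in> params M \<Longrightarrow> L_point M m \<theta> \<pi> = ereal c"
  shows "(\<lambda>k. zeta M m (\<tau> k)) \<longlonglongrightarrow> ereal (- c)"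
proof -
  have "(\<lambda>k. d_pred M m (\<tau> k) \<pi> + ereal (- c)) \<longlonglongrightarrow> 0 + ereal (- c)"
    using seq by (intro tendsto_add_ereal) (auto simp: approximating_sequence_def)
  moreover have "d_pred M m (\<tau> k) \<pi> + ereal (- c) = zeta M m (\<tau> k)" for k
    by (cases "zeta M m (\<tau> k)") (simp_all add: d_pred_def L_approximating_sequence[OF seq eq])
  ultimately show ?thesis
    by simp
qed

end

section \<open>Minimaxity and least predictive information\<close>

theorem theorem6p1:
  fixes M :: "('x, 'p::finite) model"
    and m :: "nat \<Rightarrow> nat"
    and \<pi>\<^sub>0 :: "(real ^ 'p) measure"
  assumes "valid_model M"
    and "fisher_info_exists M"
    and "jeffreys_prior M \<in> C_class M"
    and "C2_on (params M) (jeffreys_density M)"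
    and "\<forall>n\<ge>1. 0 < m n"
    and "\<pi>\<^sub>0 \<in> Phi_plus M m \<inter> C_class M \<inter> U_class M"
    and "equalizer M m \<pi>\<^sub>0"
    and "(R1 M \<pi>\<^sub>0 \<and> R1 M (jeffreys_prior M) \<and> liminf (\<lambda>n. ereal (real (m n) / real n)) > 0) \<or>
         (R2 M \<pi>\<^sub>0 \<and> R2 M (jeffreys_prior M) \<and> filterlim m at_top sequentially) \<or>
         (R3 M \<pi>\<^sub>0 \<and> R3 M (jeffreys_prior M))"
  shows "minimax M m \<pi>\<^sub>0 \<and> zeta_plus M m \<pi>\<^sub>0 = (INF \<tau>\<in>Phi M m. zeta M m \<tau>)"
proof -
  interpret statistical_model M
    by standard fact
  have J: "jeffreys_prior M \<in> Pi_inf M" "prior M (jeffreys_prior M)"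
    using assms(3) by (simp_all add: C_class_def Pi_inf_def Pi_class_def)
  have U: "\<pi>\<^sub>0 \<in> U_class M" and \<pi>\<^sub>0: "\<pi>\<^sub>0 \<in> Pi_inf M"
    using assms(6) by (simp_all add: C_class_def)
  obtain \<tau> where seq: "approximating_sequence M m \<pi>\<^sub>0 \<tau>"
    using assms(6) by (auto simp: Phi_plus_def)
  then have \<Phi>: "\<tau> k \<in> Phi M m" for k
    by (simp add: approximating_sequence_def)
  obtain c' where c': "\<And>\<theta>. \<theta> \<in> params M \<Longrightarrow> L_point M m \<theta> \<pi>\<^sub>0 = c'"
    using assms(7) by (auto simp: equalizer_def)
  obtain c where c: "\<And>\<theta>. \<theta> \<in> params M \<Longrightarrow> L_point M m \<theta> \<pi>\<^sub>0 = ereal c"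
    using equalizer_value_finite[OF seq U assms(5) J(2) c'] c' by (cases c') auto
  \<comment> \<open>The sequence is left open: the description defining \<open>zeta_plus\<close>
    needs the same limit for every approximating sequence, not only for \<tau>.\<close>
  note lim = zeta_approximating_sequence_tendsto[OF _ c]

  have L_le: "L M m \<sigma> \<pi>\<^sub>0 \<le> ereal c" if "\<sigma> \<in> Phi M m" for \<sigma>
    using PhiD[OF that] c by (intro L_le_equalizer_value[OF U assms(5) J(2)]) auto
  have le_SUP: "ereal c \<le> (SUP \<sigma>\<in>Phi M m. L M m \<sigma> \<pi>)" if "\<pi> \<in> Pi_inf M" for \<pi>
  proof (rule LIMSEQ_le_const2)
    show "(\<lambda>k. - zeta M m (\<tau> k)) \<longlonglongrightarrow> ereal c"
      using tendsto_uminus_ereal[OF lim[OF seq]] by simp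
    have "- zeta M m (\<tau> k) \<le> (SUP \<sigma>\<in>Phi M m. L M m \<sigma> \<pi>)" for k
      unfolding zeta_def ereal_uminus_uminus
      by (intro SUP_upper2[OF \<Phi>[of k]] L_self_le PhiD[OF \<Phi>[of k]] that J)
    then show "\<exists>N. \<forall>k\<ge>N. - zeta M m (\<tau> k) \<le> (SUP \<sigma>\<in>Phi M m. L M m \<sigma> \<pi>)"
      by blast
  qed
  have SUP_le: "(SUP \<sigma>\<in>Phi M m. L M m \<sigma> \<pi>\<^sub>0) \<le> ereal c"
    by (rule SUP_least) (rule L_le)
  have "minimax M m \<pi>\<^sub>0"
    unfolding minimax_def
  proof (intro conjI antisym)
    show "(SUP \<sigma>\<in>Phi M m. L M m \<sigma> \<pi>\<^sub>0) \<le> (INF \<pi>\<in>Pi_inf M. SUP \<sigma>\<in>Phi M m. L M m \<sigma> \<pi>)"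
      by (rule order_trans[OF SUP_le INF_greatest]) (rule le_SUP)
    show "(INF \<pi>\<in>Pi_inf M. SUP \<sigma>\<in>Phi M m. L M m \<sigma> \<pi>) \<le> (SUP \<sigma>\<in>Phi M m. L M m \<sigma> \<pi>\<^sub>0)"
      by (rule INF_lower[OF \<pi>\<^sub>0])
  qed fact
  \<comment> \<open>The limit -c is common to all approximating sequences. That at least one exists,
    namely \<tau>, makes the described value unique.\<close>
  moreover have "zeta_plus M m \<pi>\<^sub>0 = ereal (- c)"
    unfolding zeta_plus_def using lim LIMSEQ_unique[OF _ lim[OF seq]] seq
    by (intro the_equality) blast+
  moreover have "(INF \<sigma>\<in>Phi M m. zeta M m \<sigma>) = ereal (- c)"
  proof (rule antisym)
    show "(INF \<sigma>\<in>Phi M m. zeta M m \<sigma>) \<le> ereal (- c)"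
      by (rule LIMSEQ_le_const[OF lim[OF seq]]) (auto intro: INF_lower \<Phi>)
    show "ereal (- c) \<le> (INF \<sigma>\<in>Phi M m. zeta M m \<sigma>)"
    proof (rule INF_greatest)
      fix \<sigma> assume \<sigma>: "\<sigma> \<in> Phi M m"
      have "L M m \<sigma> \<sigma> \<le> L M m \<sigma> \<pi>\<^sub>0"
        using PhiD[OF \<sigma>] by (intro L_self_le \<pi>\<^sub>0 J)
      also have "\<dots> \<le> ereal c"
        by (rule L_le[OF \<sigma>])
      finally show "ereal (- c) \<le> zeta M m \<sigma>"
        unfolding zeta_def by (simp add: ereal_uminus_le_reorder flip: uminus_ereal.simps)
    qed
  qed
  ultimately show ?thesis
    by simp
qed

end
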